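(* Let $T=\mathbb{C}/(\mathbb{Z}\omega_1+\mathbb{Z}\omega_2)$ be a flat torus with Green function $G$ and Weierstrass function $\wp$. Let $z_0$ and $z_1$ be two half period points of $T$. Then $$G(z_0)\ge G(z_1)\quad\text{if and only if}\quad|\wp(z_0)|\ge|\wp(z_1)|.$$
   Context: $\omega_1,\omega_2\in\mathbb{C}$ are linearly independent over $\mathbb{R}$. The half period points are $\frac12\omega_1,\frac12\omega_2,\frac12(\omega_1+\omega_2)$. $\wp$ is the Weierstrass elliptic function of the lattice $\mathbb{Z}\omega_1+\mathbb{Z}\omega_2$. The Green function is $G(z)=G(z,0)$, where $G(z,w)$ is the unique function on $T\times T$ with $-\triangle_z G(z,w)=\delta_w(z)-\frac1{|T|}$ and $\int_T G(z,w)\,dA=0$. *)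

theory Defs
  imports "HOL-Complex_Analysis.Complex_Analysis"
begin

text \<open>
  Functions on the torus \<open>T = \<complex> / (\<int>\<omega>1 + \<int>\<omega>2)\<close> are represented by functions on \<open>\<complex>\<close> that are
  periodic with respect to the lattice, and integrals over \<open>T\<close> by Lebesgue integrals over the
  half-open fundamental parallelogram.
\<close>

definition period_lattice :: "complex \<Rightarrow> complex \<Rightarrow> complex set" where
  "period_lattice \<omega>1 \<omega>2 = {of_int m * \<omega>1 + of_int n * \<omega>2 |m n. True}"

definition fundamental_parallelogram :: "complex \<Rightarrow> complex \<Rightarrow> complex set" where
  "fundamental_parallelogram \<omega>1 \<omega>2 =
     {of_real s * \<omega>1 + of_real t * \<omega>2 |s t. 0 \<le> s \<and> s < 1 \<and> 0 \<le> t \<and> t < 1}"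

definition torus_integral :: "complex \<Rightarrow> complex \<Rightarrow> (complex \<Rightarrow> real) \<Rightarrow> real" where
  "torus_integral \<omega>1 \<omega>2 f = (LINT z:fundamental_parallelogram \<omega>1 \<omega>2|lborel. f z)"

definition torus_area :: "complex \<Rightarrow> complex \<Rightarrow> real" where
  "torus_area \<omega>1 \<omega>2 = measure lborel (fundamental_parallelogram \<omega>1 \<omega>2)"

definition lattice_periodic :: "complex \<Rightarrow> complex \<Rightarrow> (complex \<Rightarrow> 'a) \<Rightarrow> bool" where
  "lattice_periodic \<omega>1 \<omega>2 f \<longleftrightarrow> (\<forall>z. \<forall>\<omega>\<in>period_lattice \<omega>1 \<omega>2. f (z + \<omega>) = f z)"

definition half_period_points :: "complex \<Rightarrow> complex \<Rightarrow> complex set" where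
  "half_period_points \<omega>1 \<omega>2 = {\<omega>1 / 2, \<omega>2 / 2, (\<omega>1 + \<omega>2) / 2}"

definition weierstrass_p :: "complex \<Rightarrow> complex \<Rightarrow> complex \<Rightarrow> complex" where
  "weierstrass_p \<omega>1 \<omega>2 z =
     1 / z\<^sup>2 + (\<Sum>\<^sub>\<infinity>\<omega>\<in>period_lattice \<omega>1 \<omega>2 - {0}. 1 / (z - \<omega>)\<^sup>2 - 1 / \<omega>\<^sup>2)"

definition dir_deriv :: "complex \<Rightarrow> (complex \<Rightarrow> real) \<Rightarrow> complex \<Rightarrow> real" where
  "dir_deriv v f z = frechet_derivative f (at z) v"

definition laplacian :: "(complex \<Rightarrow> real) \<Rightarrow> complex \<Rightarrow> real" where
  "laplacian f z = dir_deriv 1 (dir_deriv 1 f) z + dir_deriv \<i> (dir_deriv \<i> f) z"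

text \<open>
  Real \<open>C\<^sup>\<infinity>\<close> functions on the plane: all iterated partial derivatives in the
  coordinate directions \<open>1\<close> and \<open>\<i>\<close> are (Frechet) differentiable everywhere, hence continuous.
\<close>
definition smooth_fun :: "(complex \<Rightarrow> real) \<Rightarrow> bool" where
  "smooth_fun f \<longleftrightarrow> (\<forall>vs\<in>lists {1, \<i>}. \<forall>z. foldr dir_deriv vs f differentiable (at z))"

text \<open>
  The Green function \<open>G(z,w)\<close> of the torus. The equation
  \<open>- \<triangle>\<^sub>z G(z,w) = \<delta>\<^sub>w(z) - 1 / |T|\<close> is meant in the sense of distributions on \<open>T\<close>, that is, it is
  tested against all smooth periodic functions. A distribution only determines \<open>G(\<cdot>,w)\<close> almost
  everywhere, so continuity away from the singularity \<open>w\<close> is required to make point values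
  meaningful. As \<open>G(w,w) = +\<infinity>\<close>, the real value of \<open>G\<close> on the diagonal is left unconstrained
  (apart from periodicity).
\<close>
definition is_green_function ::
    "complex \<Rightarrow> complex \<Rightarrow> (complex \<Rightarrow> complex \<Rightarrow> real) \<Rightarrow> bool" where
  "is_green_function \<omega>1 \<omega>2 G \<longleftrightarrow>
     (\<forall>z. lattice_periodic \<omega>1 \<omega>2 (G z)) \<and>
     (\<forall>w. lattice_periodic \<omega>1 \<omega>2 (\<lambda>z. G z w) \<and>
          continuous_on {z. z - w \<notin> period_lattice \<omega>1 \<omega>2} (\<lambda>z. G z w) \<and>
          set_integrable lborel (fundamental_parallelogram \<omega>1 \<omega>2) (\<lambda>z. G z w) \<and>
          (\<forall>\<phi>. smooth_fun \<phi> \<longrightarrow> lattice_periodic \<omega>1 \<omega>2 \<phi> \<longrightarrow>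
             - torus_integral \<omega>1 \<omega>2 (\<lambda>z. G z w * laplacian \<phi> z) =
             \<phi> w - torus_integral \<omega>1 \<omega>2 \<phi> / torus_area \<omega>1 \<omega>2) \<and>
          torus_integral \<omega>1 \<omega>2 (\<lambda>z. G z w) = 0)"

end

theory Submission
  imports Defs
begin

text \<open>
  Let \<open>a\<close> and \<open>b\<close> be two half periods, \<open>c = a + b\<close> the third one modulo the lattice, and let \<open>e\<close>
  denote values of the Weierstrass function \<open>\<wp>\<close>. The function \<open>f = \<wp> - e(c)\<close> has a double pole at \<open>0\<close>
  and a double zero at \<open>c\<close>, so that \<open>f(z) f(z + c)\<close> is elliptic without poles, hence a constant \<open>\<kappa>\<close>
  (\<open>wp_half_period_product\<close>). After a shift and a normalisation one obtains a function
  \<open>F(z) = k (\<wp>(z - a) - e(c))\<close> with \<open>k\<^sup>2 \<kappa> = 1\<close> that has a double pole at \<open>a\<close>, a double zero at \<open>b\<close>, and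
  satisfies \<open>F(z) F(z + c) = 1\<close>. Thus \<open>log |F|\<close> changes sign under the translation by \<open>c\<close>, so it has
  mean \<open>0\<close> on the torus, and its distributional Laplacian is \<open>4\<pi> (\<delta>\<^sub>b - \<delta>\<^sub>a)\<close>. Pairing it with the Green
  function gives \<open>4\<pi> (G(a) - G(b)) = log |F(0)|\<close>. The constants work out to
  \<open>|F(0)|\<^sup>2 = |e(a) - e(c)| / |e(b) - e(c)|\<close>, hence \<open>G(a) \<ge> G(b)\<close> if and only if
  \<open>|e(a) - e(c)| \<ge> |e(b) - e(c)|\<close>, and because of \<open>e(a) + e(b) + e(c) = 0\<close>
  (\<open>wp_half_periods_sum\<close>) this means \<open>|e(a)| \<ge> |e(b)|\<close>.

  The Green function may be paired with smooth functions only, so \<open>log |F|\<close> is regularised to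
  \<open>\<phi>\<^sub>s\<^sub>,\<^sub>t = 1/2 log ((|F|\<^sup>2 + s) / (|F|\<^sup>2 + t))\<close>, which extends smoothly over the poles of \<open>F\<close>. Its
  Laplacian is \<open>\<mu>\<^sub>s - \<mu>\<^sub>t\<close> for nonnegative densities \<open>\<mu>\<^sub>s\<close>. Since the Laplacian of a periodic function
  integrates to \<open>0\<close> (\<open>torus_integral_laplacian_0\<close>), all \<open>\<mu>\<^sub>s\<close> have the same total mass. The mass of \<open>\<mu>\<^sub>s\<close>
  concentrates at the zero \<open>b\<close> when \<open>s\<close> tends to \<open>0\<close>, and at the pole \<open>a\<close> when \<open>s\<close> tends to infinity.
  With \<open>t = 1 / s\<close> the equation \<open>F(z) F(z + c) = 1\<close> determines the mean of \<open>\<phi>\<^sub>s\<^sub>,\<^sub>t\<close>, and the limit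
  \<open>s \<rightarrow> 0\<close> yields \<open>mass * (G(a,w) - G(b,w)) = log |F(w)|\<close> for every source point \<open>w\<close>
  other than the zeros and poles of \<open>F\<close> (\<open>green_function_difference\<close>). Instead of evaluating the mass
  (it is \<open>4\<pi>\<close>), the proof only shows that it is positive: it is nonnegative, and it cannot vanish
  because some \<open>w\<close> near the zero \<open>b\<close> has \<open>0 < |F(w)| < 1\<close>.
\<close>

section \<open>Smooth functions on the plane\<close>

text \<open>
  An inductive form of smoothness, relative to a set. In contrast to a quantification over lists
  of directions it allows closure properties to be proved by induction on the order, and local
  formulas for a function to be patched together.
\<close>
primrec smooth_upto :: "nat \<Rightarrow> complex set \<Rightarrow> (complex \<Rightarrow> real) \<Rightarrow> bool" where
  "smooth_upto 0 U f \<longleftrightarrow> True"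
| "smooth_upto (Suc n) U f \<longleftrightarrow>
     (\<forall>z\<in>U. f differentiable (at z)) \<and> (\<forall>v\<in>{1, \<i>}. smooth_upto n U (dir_deriv v f))"

lemma dir_deriv_eqI: "(f has_derivative f') (at z) \<Longrightarrow> dir_deriv v f z = f' v"
  by (simp add: dir_deriv_def frechet_derivative_at[symmetric])

lemma dir_deriv_cong:
  assumes "open U" "z \<in> U" "\<And>x. x \<in> U \<Longrightarrow> f x = g x" "f differentiable (at z)"
  shows "dir_deriv v g z = dir_deriv v f z"
proof -
  have "(f has_derivative frechet_derivative f (at z)) (at z)"
    using assms(4) frechet_derivative_works by blast
  then have "(g has_derivative frechet_derivative f (at z)) (at z)"
    using assms(1-3) has_derivative_transform_within_open by blast
  from dir_deriv_eqI[OF this] show ?thesis by (simp add: dir_deriv_def)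
qed

lemma differentiable_cong_open:
  fixes f g :: "complex \<Rightarrow> real"
  assumes "open U" "z \<in> U" "\<And>x. x \<in> U \<Longrightarrow> f x = g x" "f differentiable (at z)"
  shows "g differentiable (at z)"
  using assms has_derivative_transform_within_open unfolding differentiable_def by metis

lemma smooth_upto_cong:
  assumes "open U" "\<And>x. x \<in> U \<Longrightarrow> f x = g x" "smooth_upto n U f"
  shows "smooth_upto n U g"
  using assms(2,3)
proof (induction n arbitrary: f g)
  case (Suc n)
  have d: "f differentiable (at z)" if "z \<in> U" for z using Suc.prems that by simp
  have "smooth_upto n U (dir_deriv v g)" if v: "v \<in> {1, \<i>}" for v
  proof (rule Suc.IH)
    show "smooth_upto n U (dir_deriv v f)" using Suc.prems v by auto
    show "\<And>x. x \<in> U \<Longrightarrow> dir_deriv v f x = dir_deriv v g x"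
      using dir_deriv_cong[OF assms(1)] Suc.prems(1) d by metis
  qed
  then show ?case using differentiable_cong_open[OF assms(1)] Suc.prems(1) d by (simp, metis)
qed simp

lemma smooth_upto_local:
  assumes "\<And>z. z \<in> U \<Longrightarrow> \<exists>V. z \<in> V \<and> smooth_upto n V f"
  shows "smooth_upto n U f"
  using assms
proof (induction n arbitrary: f)
  case (Suc n)
  have "smooth_upto n U (dir_deriv v f)" if v: "v \<in> {1, \<i>}" for v
  proof (rule Suc.IH)
    fix z assume "z \<in> U"
    from Suc.prems[OF this] obtain V where "z \<in> V" "smooth_upto (Suc n) V f" by blast
    with v show "\<exists>V. z \<in> V \<and> smooth_upto n V (dir_deriv v f)" by (intro exI[of _ V]) auto
  qed
  moreover have "f differentiable (at z)" if "z \<in> U" for z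
    using Suc.prems[OF that] by auto
  ultimately show ?case by simp
qed simp

lemma smooth_upto_SucD: "smooth_upto (Suc n) U f \<Longrightarrow> smooth_upto n U f"
proof (induction n arbitrary: f)
  case (Suc n)
  have "smooth_upto n U (dir_deriv v f)" if "v \<in> {1, \<i>}" for v
    by (rule Suc.IH) (use Suc.prems that in \<open>(simp only: smooth_upto.simps(2), blast)\<close>)
  moreover have "\<forall>z\<in>U. f differentiable (at z)" using Suc.prems by (simp only: smooth_upto.simps(2)) blast
  ultimately show ?case by (simp only: smooth_upto.simps(2)) blast
qed simp

lemma dir_deriv_const [simp]: "dir_deriv v (\<lambda>_. c) = (\<lambda>_. 0)"
  by (rule ext, rule dir_deriv_eqI) simp

lemma smooth_upto_const: "smooth_upto n U (\<lambda>_. c)"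
  by (induction n arbitrary: c) simp_all

lemma dir_deriv_add:
  assumes "f differentiable (at z)" "g differentiable (at z)"
  shows "dir_deriv v (\<lambda>x. f x + g x) z = dir_deriv v f z + dir_deriv v g z"
proof -
  have "((\<lambda>x. f x + g x) has_derivative
      (\<lambda>h. frechet_derivative f (at z) h + frechet_derivative g (at z) h)) (at z)"
    using assms unfolding frechet_derivative_works by (rule has_derivative_add)
  from dir_deriv_eqI[OF this] show ?thesis by (simp add: dir_deriv_def)
qed

lemma dir_deriv_mult:
  assumes "f differentiable (at z)" "g differentiable (at z)"
  shows "dir_deriv v (\<lambda>x. f x * g x) z = dir_deriv v f z * g z + f z * dir_deriv v g z"
proof -
  have "((\<lambda>x. f x * g x) has_derivative
      (\<lambda>h. f z * frechet_derivative g (at z) h + frechet_derivative f (at z) h * g z)) (at z)"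
    using assms unfolding frechet_derivative_works by (rule has_derivative_mult)
  from dir_deriv_eqI[OF this] show ?thesis by (simp add: dir_deriv_def)
qed

lemma smooth_upto_add:
  assumes "open U" "smooth_upto n U f" "smooth_upto n U g"
  shows "smooth_upto n U (\<lambda>x. f x + g x)"
  using assms(2,3)
proof (induction n arbitrary: f g)
  case (Suc n)
  have "smooth_upto n U (dir_deriv v (\<lambda>x. f x + g x))" if "v \<in> {1, \<i>}" for v
  proof (rule smooth_upto_cong[OF assms(1)])
    show "smooth_upto n U (\<lambda>x. dir_deriv v f x + dir_deriv v g x)"
      by (rule Suc.IH) (use Suc.prems that in auto)
  qed (use Suc.prems dir_deriv_add in auto)
  then show ?case using Suc.prems by (auto intro: differentiable_add)
qed simp

lemma smooth_upto_mult:
  assumes "open U" "smooth_upto n U f" "smooth_upto n U g"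
  shows "smooth_upto n U (\<lambda>x. f x * g x)"
  using assms(2,3)
proof (induction n arbitrary: f g)
  case (Suc n)
  have "smooth_upto n U (dir_deriv v (\<lambda>x. f x * g x))" if v: "v \<in> {1, \<i>}" for v
  proof (rule smooth_upto_cong[OF assms(1)])
    have "smooth_upto n U (dir_deriv v f)" "smooth_upto n U (dir_deriv v g)"
      using Suc.prems v by auto
    moreover have "smooth_upto n U f" "smooth_upto n U g"
      using smooth_upto_SucD[OF Suc.prems(1)] smooth_upto_SucD[OF Suc.prems(2)] by blast+
    ultimately show "smooth_upto n U (\<lambda>x. dir_deriv v f x * g x + f x * dir_deriv v g x)"
      by (intro smooth_upto_add[OF assms(1)] Suc.IH)
  qed (use Suc.prems dir_deriv_mult in auto)
  then show ?case using Suc.prems by (auto intro: differentiable_mult)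
qed simp

lemma dir_deriv_chain:
  assumes "f differentiable (at z)" "(h has_field_derivative h') (at (f z))"
  shows "dir_deriv v (\<lambda>x. h (f x)) z = h' * dir_deriv v f z"
    and "(\<lambda>x. h (f x)) differentiable (at z)"
proof -
  have "((\<lambda>x. h (f x)) has_derivative (\<lambda>k. h' * frechet_derivative f (at z) k)) (at z)"
    using has_derivative_compose[OF assms(1)[unfolded frechet_derivative_works]
            assms(2)[unfolded has_field_derivative_def]] .
  then show "dir_deriv v (\<lambda>x. h (f x)) z = h' * dir_deriv v f z"
    and "(\<lambda>x. h (f x)) differentiable (at z)"
    by (auto simp: dir_deriv_def dest: dir_deriv_eqI differentiableI)
qed

text \<open>
  The derivative of \<open>1/f\<close> is a polynomial in \<open>1/f\<close> and the derivative of \<open>f\<close>, so the induction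
  reproduces the function itself.
\<close>
lemma smooth_upto_inverse:
  assumes "open U" "smooth_upto n U f" "\<And>x. x \<in> U \<Longrightarrow> f x \<noteq> 0"
  shows "smooth_upto n U (\<lambda>x. inverse (f x))"
  using assms(2)
proof (induction n)
  case (Suc n)
  have chain: "dir_deriv v (\<lambda>x. inverse (f x)) z
        = - (inverse (f z) * inverse (f z)) * dir_deriv v f z"
      "(\<lambda>x. inverse (f x)) differentiable (at z)" if "z \<in> U" for z v
  proof -
    have "f differentiable (at z)" using Suc.prems that by simp
    moreover have "(inverse has_field_derivative - (inverse (f z) * inverse (f z))) (at (f z))"
      using DERIV_inverse[OF assms(3)[OF that]] by (simp add: power2_eq_square)
    ultimately show "dir_deriv v (\<lambda>x. inverse (f x)) z
        = - (inverse (f z) * inverse (f z)) * dir_deriv v f z"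
      "(\<lambda>x. inverse (f x)) differentiable (at z)"
      by (fact dir_deriv_chain)+
  qed
  have IH: "smooth_upto n U (\<lambda>x. inverse (f x))"
    by (rule Suc.IH[OF smooth_upto_SucD[OF Suc.prems]])
  have "smooth_upto n U (dir_deriv v (\<lambda>x. inverse (f x)))" if v: "v \<in> {1, \<i>}" for v
  proof (rule smooth_upto_cong[OF assms(1)])
    show "smooth_upto n U (\<lambda>x. (- 1 * (inverse (f x) * inverse (f x))) * dir_deriv v f x)"
      using Suc.prems v by (intro smooth_upto_mult[OF assms(1)] smooth_upto_const IH) auto
  qed (use chain in auto)
  then show ?case using chain by simp
qed simp

lemma smooth_upto_ln:
  assumes "open U" "smooth_upto n U f" "\<And>x. x \<in> U \<Longrightarrow> f x > 0"
  shows "smooth_upto n U (\<lambda>x. ln (f x))"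
proof (cases n)
  case (Suc m)
  have chain: "dir_deriv v (\<lambda>x. ln (f x)) z = inverse (f z) * dir_deriv v f z"
      "(\<lambda>x. ln (f x)) differentiable (at z)" if "z \<in> U" for z v
  proof -
    have "f differentiable (at z)" using assms(2) that Suc by simp
    moreover have "(ln has_field_derivative inverse (f z)) (at (f z))"
      using DERIV_ln[OF assms(3)[OF that]] .
    ultimately show "dir_deriv v (\<lambda>x. ln (f x)) z = inverse (f z) * dir_deriv v f z"
      "(\<lambda>x. ln (f x)) differentiable (at z)"
      by (fact dir_deriv_chain)+
  qed
  have "smooth_upto m U (dir_deriv v (\<lambda>x. ln (f x)))" if v: "v \<in> {1, \<i>}" for v
  proof (rule smooth_upto_cong[OF assms(1)])
    have "smooth_upto m U f" using smooth_upto_SucD[OF assms(2)[unfolded Suc]] .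
    moreover have "f x \<noteq> 0" if "x \<in> U" for x using assms(3)[OF that] by simp
    ultimately show "smooth_upto m U (\<lambda>x. inverse (f x) * dir_deriv v f x)"
      using assms v Suc
      by (intro smooth_upto_mult[OF assms(1)] smooth_upto_inverse) auto
  qed (use chain in auto)
  then show ?thesis using chain Suc by simp
qed simp

lemma Re_holomorphic_dir_deriv:
  assumes "open U" "h holomorphic_on U" "z \<in> U"
  shows "dir_deriv v (\<lambda>x. Re (h x)) z = Re (v * deriv h z)"
    and "(\<lambda>x. Re (h x)) differentiable (at z)"
proof -
  have "(h has_derivative (*) (deriv h z)) (at z)"
    using holomorphic_derivI[OF assms(2,1,3)] by (simp add: has_field_derivative_def)
  then have "((\<lambda>x. Re (h x)) has_derivative (\<lambda>v. Re (deriv h z * v))) (at z)"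
    by (rule has_derivative_Re)
  then show "dir_deriv v (\<lambda>x. Re (h x)) z = Re (v * deriv h z)"
    and "(\<lambda>x. Re (h x)) differentiable (at z)"
    by (auto dest: dir_deriv_eqI differentiableI simp: mult.commute)
qed

lemma smooth_upto_Re:
  assumes "open U" "h holomorphic_on U"
  shows "smooth_upto n U (\<lambda>x. Re (h x))"
  using assms(2)
proof (induction n arbitrary: h)
  case (Suc n)
  have "smooth_upto n U (dir_deriv v (\<lambda>x. Re (h x)))" for v
  proof (rule smooth_upto_cong[OF assms(1)])
    show "smooth_upto n U (\<lambda>x. Re (v * deriv h x))"
      using Suc.prems assms(1) by (intro Suc.IH holomorphic_intros)
  qed (use Re_holomorphic_dir_deriv[OF assms(1) Suc.prems] in auto)
  then show ?case using Re_holomorphic_dir_deriv[OF assms(1) Suc.prems] by auto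
qed simp

lemma smooth_upto_norm_square:
  assumes "open U" "h holomorphic_on U"
  shows "smooth_upto n U (\<lambda>x. (norm (h x))\<^sup>2 + c)"
proof -
  have "(\<lambda>x. (norm (h x))\<^sup>2 + c)
      = (\<lambda>x. Re (h x) * Re (h x) + Re (- \<i> * h x) * Re (- \<i> * h x) + c)"
    by (simp add: cmod_power2) (simp add: power2_eq_square)
  moreover have "smooth_upto n U
      (\<lambda>x. Re (h x) * Re (h x) + Re (- \<i> * h x) * Re (- \<i> * h x) + c)"
    by (intro smooth_upto_add smooth_upto_mult smooth_upto_Re smooth_upto_const
         holomorphic_intros assms)
  ultimately show ?thesis by simp
qed

lemma smooth_fun_iff_smooth_upto: "smooth_fun f \<longleftrightarrow> (\<forall>n. smooth_upto n UNIV f)"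
proof
  assume *: "\<forall>n. smooth_upto n UNIV f"
  have "foldr dir_deriv vs f differentiable (at z)" if "vs \<in> lists {1, \<i>}" for vs z
    using that *
  proof (induction vs arbitrary: f rule: rev_induct)
    case Nil
    then have "smooth_upto (Suc 0) UNIV f" by blast
    then show ?case by simp
  next
    case (snoc v vs)
    have "smooth_upto n UNIV (dir_deriv v f)" for n
      using snoc.prems(2)[rule_format, of "Suc n"] snoc.prems(1) by auto
    then show ?case using snoc by simp
  qed
  then show "smooth_fun f" by (simp add: smooth_fun_def)
next
  assume *: "smooth_fun f"
  have "smooth_upto n UNIV f" if "\<forall>vs\<in>lists {1, \<i>}. \<forall>z. foldr dir_deriv vs f differentiable (at z)" for n
    using that
  proof (induction n arbitrary: f)
    case (Suc n)
    have "smooth_upto n UNIV (dir_deriv v f)" if "v \<in> {1, \<i>}" for v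
    proof (rule Suc.IH, intro ballI allI)
      fix vs z assume "vs \<in> lists {1, \<i>}"
      with that have "vs @ [v] \<in> lists {1, \<i>}" by auto
      from Suc.prems[rule_format, OF this] show "foldr dir_deriv vs (dir_deriv v f) differentiable (at z)"
        by simp
    qed
    moreover have "f differentiable (at z)" for z using Suc.prems[rule_format, of "[]"] by simp
    ultimately show ?case by simp
  qed simp
  then show "\<forall>n. smooth_upto n UNIV f" using * by (simp add: smooth_fun_def)
qed

lemma laplacian_cong:
  assumes "open U" "z \<in> U" "\<And>x. x \<in> U \<Longrightarrow> f x = g x" "smooth_upto 2 U f"
  shows "laplacian g z = laplacian f z"
proof -
  have s: "\<forall>x\<in>U. f differentiable (at x)" "\<And>v. v \<in> {1, \<i>} \<Longrightarrow> \<forall>x\<in>U. dir_deriv v f differentiable (at x)"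
    using assms(4) by (auto simp: numeral_2_eq_2)
  have "dir_deriv v (dir_deriv v g) z = dir_deriv v (dir_deriv v f) z" if v: "v \<in> {1, \<i>}" for v
  proof (rule dir_deriv_cong[OF assms(1,2)])
    show "dir_deriv v f x = dir_deriv v g x" if "x \<in> U" for x
      using dir_deriv_cong[OF assms(1) that assms(3)] s(1) that by simp
    show "dir_deriv v f differentiable (at z)" using s(2)[OF v] assms(2) by blast
  qed
  then show ?thesis by (simp add: laplacian_def)
qed

lemma dir_deriv_affine_diff:
  assumes "f differentiable (at z)" "g differentiable (at z)"
  shows "dir_deriv v (\<lambda>x. f x - g x + k) z = dir_deriv v f z - dir_deriv v g z"
    and "(\<lambda>x. f x - g x + k) differentiable (at z)"
proof -
  have "((\<lambda>x. f x - g x + k) has_derivative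
      (\<lambda>h. frechet_derivative f (at z) h - frechet_derivative g (at z) h + 0)) (at z)"
    using assms unfolding frechet_derivative_works
    by (intro has_derivative_add has_derivative_diff has_derivative_const)
  from dir_deriv_eqI[OF this] differentiableI[OF this]
  show "dir_deriv v (\<lambda>x. f x - g x + k) z = dir_deriv v f z - dir_deriv v g z"
    and "(\<lambda>x. f x - g x + k) differentiable (at z)" by (simp_all add: dir_deriv_def)
qed

lemma laplacian_affine_diff:
  assumes U: "open U" "z \<in> U" and f: "smooth_upto 2 U f" and g: "smooth_upto 2 U g"
  shows "laplacian (\<lambda>x. f x - g x + k) z = laplacian f z - laplacian g z"
proof -
  have s: "\<forall>x\<in>U. f differentiable (at x)" "\<And>v. v \<in> {1, \<i>} \<Longrightarrow> \<forall>x\<in>U. dir_deriv v f differentiable (at x)"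
    "\<forall>x\<in>U. g differentiable (at x)" "\<And>v. v \<in> {1, \<i>} \<Longrightarrow> \<forall>x\<in>U. dir_deriv v g differentiable (at x)"
    using f g by (auto simp: numeral_2_eq_2)
  have "dir_deriv v (dir_deriv v (\<lambda>x. f x - g x + k)) z
      = dir_deriv v (dir_deriv v f) z - dir_deriv v (dir_deriv v g) z" if v: "v \<in> {1, \<i>}" for v
  proof -
    have d: "dir_deriv v f differentiable (at z)" "dir_deriv v g differentiable (at z)"
      using s(2,4)[OF v] U(2) by blast+
    have "dir_deriv v (dir_deriv v (\<lambda>x. f x - g x + k)) z
        = dir_deriv v (\<lambda>x. dir_deriv v f x - dir_deriv v g x + 0) z"
    proof (rule dir_deriv_cong[OF U])
      show "dir_deriv v f x - dir_deriv v g x + 0 = dir_deriv v (\<lambda>x. f x - g x + k) x" if "x \<in> U" for x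
        using dir_deriv_affine_diff(1)[of f x g v k] s(1,3) that by simp
      show "(\<lambda>x. dir_deriv v f x - dir_deriv v g x + 0) differentiable (at z)"
        by (rule dir_deriv_affine_diff(2)[OF d])
    qed
    also have "\<dots> = dir_deriv v (dir_deriv v f) z - dir_deriv v (dir_deriv v g) z"
      by (rule dir_deriv_affine_diff(1)[OF d])
    finally show ?thesis .
  qed
  then show ?thesis by (simp add: laplacian_def)
qed

lemma smooth_upto_affine_diff:
  assumes "open U" "smooth_upto n U f" "smooth_upto n U g"
  shows "smooth_upto n U (\<lambda>x. f x - g x + k)"
proof -
  have "smooth_upto n U (\<lambda>x. f x + (- 1) * g x + k)"
    by (intro smooth_upto_add smooth_upto_mult smooth_upto_const assms)
  then show ?thesis by simp
qed

section \<open>The regularised logarithm of a holomorphic function\<close>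

text \<open>
  Up to a factor, the pullback under \<open>h\<close> of the area form of the Riemann sphere, rescaled by
  \<open>sqrt a\<close>. This is why its total mass on a torus is independent of \<open>a\<close>.
\<close>
definition spherical_density :: "real \<Rightarrow> (complex \<Rightarrow> complex) \<Rightarrow> complex \<Rightarrow> real" where
  "spherical_density a h z = 2 * a * (norm (deriv h z))\<^sup>2 / ((norm (h z))\<^sup>2 + a)\<^sup>2"

definition log_reg :: "real \<Rightarrow> (complex \<Rightarrow> complex) \<Rightarrow> complex \<Rightarrow> real" where
  "log_reg a h z = ln ((norm (h z))\<^sup>2 + a) / 2"

lemma smooth_upto_log_reg:
  assumes "open U" "h holomorphic_on U" "a > 0"
  shows "smooth_upto n U (log_reg a h)"
proof -
  have "smooth_upto n U (\<lambda>x. 1/2 * ln ((norm (h x))\<^sup>2 + a))"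
    using assms by (intro smooth_upto_mult smooth_upto_const smooth_upto_ln smooth_upto_norm_square)
       (auto intro: add_nonneg_pos)
  then show ?thesis by (simp add: log_reg_def[abs_def])
qed

lemma dir_deriv_norm_square:
  assumes "open U" "h holomorphic_on U" "z \<in> U"
  shows "dir_deriv v (\<lambda>x. (norm (h x))\<^sup>2 + a) z = 2 * Re (v * deriv h z * cnj (h z))"
    and "(\<lambda>x. (norm (h x))\<^sup>2 + a) differentiable (at z)"
proof -
  have d: "(h has_derivative (*) (deriv h z)) (at z)"
    using holomorphic_derivI[OF assms(2,1,3)] by (simp add: has_field_derivative_def)
  have "((\<lambda>x. Re (h x) * Re (h x) + Im (h x) * Im (h x) + a) has_derivative
      (\<lambda>v. (Re (h z) * Re (deriv h z * v) + Re (deriv h z * v) * Re (h z))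
         + (Im (h z) * Im (deriv h z * v) + Im (deriv h z * v) * Im (h z)) + 0)) (at z)"
    by (intro has_derivative_add has_derivative_mult has_derivative_const
          has_derivative_Re[OF d] has_derivative_Im[OF d])
  moreover have "(\<lambda>x. Re (h x) * Re (h x) + Im (h x) * Im (h x) + a) = (\<lambda>x. (norm (h x))\<^sup>2 + a)"
    by (simp add: cmod_power2) (simp add: power2_eq_square)
  ultimately have d2: "((\<lambda>x. (norm (h x))\<^sup>2 + a) has_derivative
      (\<lambda>v. (Re (h z) * Re (deriv h z * v) + Re (deriv h z * v) * Re (h z))
         + (Im (h z) * Im (deriv h z * v) + Im (deriv h z * v) * Im (h z)) + 0)) (at z)"
    by simp
  show "dir_deriv v (\<lambda>x. (norm (h x))\<^sup>2 + a) z = 2 * Re (v * deriv h z * cnj (h z))"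
    unfolding dir_deriv_eqI[OF d2] by (simp add: algebra_simps)
  show "(\<lambda>x. (norm (h x))\<^sup>2 + a) differentiable (at z)"
    using d2 by (rule differentiableI)
qed

lemma dir_deriv_log_reg:
  assumes "open U" "h holomorphic_on U" "a > 0" "z \<in> U"
  shows "dir_deriv v (log_reg a h) z = Re (v * deriv h z * cnj (h z)) / ((norm (h z))\<^sup>2 + a)"
proof -
  have pos: "(norm (h z))\<^sup>2 + a > 0" using assms(3) by (intro add_nonneg_pos) auto
  have "((\<lambda>y. ln y / 2) has_field_derivative inverse ((norm (h z))\<^sup>2 + a) / 2) (at ((norm (h z))\<^sup>2 + a))"
    using pos by (auto intro!: derivative_eq_intros simp: field_simps)
  from dir_deriv_chain(1)[OF dir_deriv_norm_square(2)[OF assms(1,2,4)] this]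
  have "dir_deriv v (log_reg a h) z = inverse ((norm (h z))\<^sup>2 + a) / 2
      * dir_deriv v (\<lambda>x. (norm (h x))\<^sup>2 + a) z"
    by (simp only: log_reg_def[abs_def])
  also have "\<dots> = Re (v * deriv h z * cnj (h z)) / ((norm (h z))\<^sup>2 + a)"
    unfolding dir_deriv_norm_square(1)[OF assms(1,2,4)] using pos
    by (simp only: divide_inverse) simp
  finally show ?thesis .
qed

text \<open>
  With \<open>D = |h|\<^sup>2 + a\<close> and \<open>X = h' cnj(h)\<close>, the first derivative in direction \<open>v\<close> is
  \<open>Re (v X) / D\<close>. Differentiating once more produces a term \<open>Re (v\<^sup>2 h'' cnj(h)) / D\<close> that cancels
  between the directions \<open>1\<close> and \<open>\<i>\<close>, and what is left is
  \<open>2 |h'|\<^sup>2 / D - 2 |X|\<^sup>2 / D\<^sup>2 = 2 a |h'|\<^sup>2 / D\<^sup>2\<close>.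
\<close>
lemma laplacian_log_reg:
  assumes U: "open U" and h: "h holomorphic_on U" and a: "a > 0" and z: "z \<in> U"
  shows "laplacian (log_reg a h) z = spherical_density a h z"
proof -
  define D where "D = (norm (h z))\<^sup>2 + a"
  have pos: "D > 0" using a unfolding D_def by (intro add_nonneg_pos) auto
  define X where "X = deriv h z * cnj (h z)"
  define Y where "Y = deriv (deriv h) z * cnj (h z)"
  have h': "deriv h holomorphic_on U" using U h by (rule holomorphic_deriv[rotated])
  have second: "dir_deriv v (dir_deriv v (log_reg a h)) z
      = (Re (v * v * Y) + (norm v)\<^sup>2 * (norm (deriv h z))\<^sup>2) / D - 2 * (Re (v * X))\<^sup>2 / D\<^sup>2" for v
  proof -
    define q where "q = (\<lambda>x. Re (v * deriv h x * cnj (h x)) / ((norm (h x))\<^sup>2 + a))"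
    have d: "(h has_derivative (*) (deriv h z)) (at z)"
      using holomorphic_derivI[OF h U z] by (simp add: has_field_derivative_def)
    have d': "(deriv h has_derivative (*) (deriv (deriv h) z)) (at z)"
      using holomorphic_derivI[OF h' U z] by (simp add: has_field_derivative_def)
    have num: "((\<lambda>x. Re (v * deriv h x * cnj (h x))) has_derivative
        (\<lambda>k. Re (v * (deriv (deriv h) z * k) * cnj (h z) + v * deriv h z * cnj (deriv h z * k)))) (at z)"
      by (rule has_derivative_Re)
         (auto intro!: derivative_eq_intros d d' simp: algebra_simps)
    have den: "((\<lambda>x. (norm (h x))\<^sup>2 + a) has_derivative
      frechet_derivative (\<lambda>x. (norm (h x))\<^sup>2 + a) (at z)) (at z)"
      using dir_deriv_norm_square(2)[OF U h z] by (simp add: frechet_derivative_works)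
    have den': "frechet_derivative (\<lambda>x. (norm (h x))\<^sup>2 + a) (at z) v = 2 * Re (v * X)"
      using dir_deriv_norm_square(1)[OF U h z, of v a] by (simp add: dir_deriv_def X_def mult.assoc)
    have "(q has_derivative (\<lambda>k.
        (Re (v * (deriv (deriv h) z * k) * cnj (h z) + v * deriv h z * cnj (deriv h z * k)) * D
          - Re (v * deriv h z * cnj (h z)) * frechet_derivative (\<lambda>x. (norm (h x))\<^sup>2 + a) (at z) k)
        / (D * D))) (at z)"
      unfolding q_def D_def
      by (rule has_derivative_divide'[OF num den]) (use pos D_def in auto)
    note dq = this
    have q': "q differentiable (at z)" using dq by (rule differentiableI)
    have q'': "dir_deriv v q z = ((Re (v * (deriv (deriv h) z * v) * cnj (h z) + v * deriv h z * cnj (deriv h z * v))) * D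
          - Re (v * deriv h z * cnj (h z)) * (2 * Re (v * X))) / (D * D)"
      unfolding dir_deriv_eqI[OF dq] den' ..
    have "dir_deriv v (dir_deriv v (log_reg a h)) z = dir_deriv v q z"
      by (rule dir_deriv_cong[OF U z])
         (use dir_deriv_log_reg[OF U h a] q' in \<open>auto simp: q_def\<close>)
    moreover have "Re (v * (deriv (deriv h) z * v) * cnj (h z) + v * deriv h z * cnj (deriv h z * v))
        = Re (v * v * Y) + (norm v)\<^sup>2 * (norm (deriv h z))\<^sup>2"
    proof -
      have "v * deriv h z * cnj (deriv h z * v) = of_real ((norm (v * deriv h z))\<^sup>2)"
        by (simp only: complex_norm_square) (simp add: mult_ac)
      then show ?thesis by (simp add: Y_def norm_mult power_mult_distrib algebra_simps)
    qed
    moreover have "Re (v * deriv h z * cnj (h z)) = Re (v * X)" by (simp add: X_def mult.assoc)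
    ultimately show ?thesis using pos q''
      by (simp add: diff_divide_distrib power2_eq_square)
  qed
  have nX: "(Re X)\<^sup>2 + (Im X)\<^sup>2 = (norm (deriv h z))\<^sup>2 * (norm (h z))\<^sup>2"
    unfolding cmod_power2[symmetric] by (simp add: X_def norm_mult power_mult_distrib)
  have "laplacian (log_reg a h) z = 2 * (norm (deriv h z))\<^sup>2 / D - 2 * ((Re X)\<^sup>2 + (Im X)\<^sup>2) / D\<^sup>2"
    unfolding laplacian_def second by (simp add: add_divide_distrib diff_divide_distrib algebra_simps)
  also have "\<dots> = 2 * (norm (deriv h z))\<^sup>2 * (D - (norm (h z))\<^sup>2) / D\<^sup>2"
    unfolding nX using pos by (simp add: field_simps power2_eq_square)
  also have "\<dots> = spherical_density a h z"
    by (simp add: D_def spherical_density_def)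
  finally show ?thesis .
qed

lemma spherical_density_nonneg: "a > 0 \<Longrightarrow> spherical_density a h z \<ge> 0"
  by (simp add: spherical_density_def)

lemma spherical_density_le: 
  assumes "a > 0"
  shows "spherical_density a h z \<le> 2 / a * (norm (deriv h z))\<^sup>2"
proof -
  have D: "(norm (h z))\<^sup>2 + a > 0" using assms by (simp add: add_nonneg_pos)
  have "a\<^sup>2 \<le> ((norm (h z))\<^sup>2 + a)\<^sup>2" using assms by (intro power_mono) auto
  then have "spherical_density a h z \<le> 2 * a * (norm (deriv h z))\<^sup>2 / a\<^sup>2"
    unfolding spherical_density_def using assms zero_less_power[OF D, of 2]
    by (intro divide_left_mono mult_pos_pos zero_less_power) (use D in simp_all)
  also have "\<dots> = 2 / a * (norm (deriv h z))\<^sup>2" using assms by (simp add: power2_eq_square)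
  finally show ?thesis .
qed

lemma continuous_on_spherical_density:
  assumes "open U" "h holomorphic_on U" "a > 0"
  shows "continuous_on U (spherical_density a h)"
proof -
  have nz: "((norm (h z))\<^sup>2 + a)\<^sup>2 \<noteq> 0" for z
  proof -
    have "(norm (h z))\<^sup>2 + a > 0" using assms(3) by (simp add: add_nonneg_pos)
    then show ?thesis by simp
  qed
  have "continuous_on U h" "continuous_on U (deriv h)"
    using assms by (auto intro!: holomorphic_on_imp_continuous_on holomorphic_deriv)
  then show ?thesis unfolding spherical_density_def[abs_def]
    using nz by (intro continuous_intros) auto
qed

section \<open>Integration over the torus\<close>

text \<open>
  Linear independence over the reals is expressed by the determinant of the two generators, by
  which the real coordinates with respect to them are obtained from Cramer's rule.
\<close>
locale complex_lattice =
  fixes \<omega>1 \<omega>2 :: complex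
  assumes cross_nonzero: "Im (cnj \<omega>1 * \<omega>2) \<noteq> 0"
begin

abbreviation "\<Lambda> \<equiv> period_lattice \<omega>1 \<omega>2"
abbreviation "P \<equiv> fundamental_parallelogram \<omega>1 \<omega>2"

definition fst_coord :: "complex \<Rightarrow> real" where
  "fst_coord z = Im (cnj z * \<omega>2) / Im (cnj \<omega>1 * \<omega>2)"

definition snd_coord :: "complex \<Rightarrow> real" where
  "snd_coord z = Im (cnj \<omega>1 * z) / Im (cnj \<omega>1 * \<omega>2)"

lemma coord_add [simp]:
  "fst_coord (z + w) = fst_coord z + fst_coord w" "snd_coord (z + w) = snd_coord z + snd_coord w"
  by (simp_all add: fst_coord_def snd_coord_def add_divide_distrib[symmetric] algebra_simps)

lemma coord_of_real [simp]:
  "fst_coord (of_real r * z) = r * fst_coord z" "snd_coord (of_real r * z) = r * snd_coord z"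
  by (simp_all add: fst_coord_def snd_coord_def algebra_simps diff_divide_distrib)

lemma coord_of_int [simp]:
  "fst_coord (of_int k * z) = of_int k * fst_coord z" "snd_coord (of_int k * z) = of_int k * snd_coord z"
  using coord_of_real[of "of_int k" z] by simp_all

lemma coord_minus [simp]:
  "fst_coord (- z) = - fst_coord z" "snd_coord (- z) = - snd_coord z"
  using coord_of_int[of "-1" z] by simp_all

lemma coord_diff [simp]:
  "fst_coord (z - w) = fst_coord z - fst_coord w" "snd_coord (z - w) = snd_coord z - snd_coord w"
  using coord_add[of z "- w"] by simp_all

lemma coord_generators [simp]:
  "fst_coord \<omega>1 = 1" "snd_coord \<omega>1 = 0" "fst_coord \<omega>2 = 0" "snd_coord \<omega>2 = 1"
  using cross_nonzero by (simp_all add: fst_coord_def snd_coord_def)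

lemma coord_half [simp]:
  "fst_coord (z / 2) = fst_coord z / 2" "snd_coord (z / 2) = snd_coord z / 2"
  using coord_of_real[of "1/2" z] by simp_all

lemma coord_double [simp]:
  "fst_coord (2 * z) = 2 * fst_coord z" "snd_coord (2 * z) = 2 * snd_coord z"
  using coord_of_int[of 2 z] by simp_all

lemma coord_expand: "z = of_real (fst_coord z) * \<omega>1 + of_real (snd_coord z) * \<omega>2"
proof -
  define D where "D = Im (cnj \<omega>1 * \<omega>2)"
  define M where "M = Im (cnj z * \<omega>2)"
  define N where "N = Im (cnj \<omega>1 * z)"
  have D: "D \<noteq> 0" using cross_nonzero D_def by simp
  have "of_real D * z = of_real M * \<omega>1 + of_real N * \<omega>2"
    by (simp add: complex_eq_iff D_def M_def N_def algebra_simps)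
  then have "z = of_real (M / D) * \<omega>1 + of_real (N / D) * \<omega>2"
    using D by (simp add: field_simps)
  moreover have "fst_coord z = M / D" "snd_coord z = N / D"
    by (simp_all only: fst_coord_def snd_coord_def D_def M_def N_def)
  ultimately show ?thesis by (simp only:)
qed

lemma lattice_iff: "z \<in> \<Lambda> \<longleftrightarrow> fst_coord z \<in> \<int> \<and> snd_coord z \<in> \<int>"
proof
  assume "z \<in> \<Lambda>"
  then show "fst_coord z \<in> \<int> \<and> snd_coord z \<in> \<int>" by (auto simp: period_lattice_def)
next
  assume "fst_coord z \<in> \<int> \<and> snd_coord z \<in> \<int>"
  then obtain m n where "fst_coord z = of_int m" "snd_coord z = of_int n" by (auto elim!: Ints_cases)
  then show "z \<in> \<Lambda>" using coord_expand[of z] unfolding period_lattice_def by auto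
qed

lemma parallelogram_iff:
  "z \<in> P \<longleftrightarrow> 0 \<le> fst_coord z \<and> fst_coord z < 1 \<and> 0 \<le> snd_coord z \<and> snd_coord z < 1"
  unfolding fundamental_parallelogram_def using coord_expand[of z] by auto

lemma lattice_0 [simp]: "0 \<in> \<Lambda>"
  by (simp add: lattice_iff fst_coord_def snd_coord_def)

lemma lattice_add: "z \<in> \<Lambda> \<Longrightarrow> w \<in> \<Lambda> \<Longrightarrow> z + w \<in> \<Lambda>"
  and lattice_diff: "z \<in> \<Lambda> \<Longrightarrow> w \<in> \<Lambda> \<Longrightarrow> z - w \<in> \<Lambda>"
  and lattice_minus: "z \<in> \<Lambda> \<Longrightarrow> - z \<in> \<Lambda>"
  by (auto simp: lattice_iff)

lemma continuous_coord: "continuous_on UNIV fst_coord" "continuous_on UNIV snd_coord"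
  unfolding fst_coord_def[abs_def] snd_coord_def[abs_def]
  using cross_nonzero by (auto intro!: continuous_intros)

lemma measurable_coord [measurable]:
  "fst_coord \<in> borel_measurable borel" "snd_coord \<in> borel_measurable borel"
  using continuous_coord by (auto intro: borel_measurable_continuous_onI)

lemma coord_bound: "\<exists>C>0. \<forall>z. \<bar>fst_coord z\<bar> \<le> C * norm z \<and> \<bar>snd_coord z\<bar> \<le> C * norm z"
proof -
  define D where "D = \<bar>Im (cnj \<omega>1 * \<omega>2)\<bar>"
  have D: "D > 0" using cross_nonzero D_def by simp
  have "\<bar>Im (cnj z * w)\<bar> \<le> norm z * norm w" for z w
    using abs_Im_le_cmod[of "cnj z * w"] by (simp add: norm_mult)
  then have "\<bar>fst_coord z\<bar> \<le> (norm z * norm \<omega>2) / D" "\<bar>snd_coord z\<bar> \<le> (norm \<omega>1 * norm z) / D" for z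
    using D by (simp_all only: fst_coord_def snd_coord_def abs_divide D_def[symmetric] divide_right_mono less_imp_le)
  moreover have "(norm z * norm \<omega>2) / D \<le> (norm \<omega>1 + norm \<omega>2 + 1) / D * norm z"
    "(norm \<omega>1 * norm z) / D \<le> (norm \<omega>1 + norm \<omega>2 + 1) / D * norm z" for z
    using D by (auto simp: divide_simps algebra_simps)
  ultimately have "\<bar>fst_coord z\<bar> \<le> (norm \<omega>1 + norm \<omega>2 + 1) / D * norm z
       \<and> \<bar>snd_coord z\<bar> \<le> (norm \<omega>1 + norm \<omega>2 + 1) / D * norm z" for z
    using order_trans by blast
  moreover have "(norm \<omega>1 + norm \<omega>2 + 1) / D > 0" using D by (simp add: add_nonneg_pos)
  ultimately show ?thesis by blast
qed

lemma countable_lattice: "countable \<Lambda>"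
proof -
  have "\<Lambda> = (\<lambda>(m, n). of_int m * \<omega>1 + of_int n * \<omega>2) ` (UNIV :: (int \<times> int) set)"
    by (auto simp: period_lattice_def image_iff)
  then show ?thesis by simp
qed

lemma parallelogram_borel [measurable]: "P \<in> sets borel"
proof -
  have "P = {z \<in> space borel. 0 \<le> fst_coord z \<and> fst_coord z < 1 \<and> 0 \<le> snd_coord z \<and> snd_coord z < 1}"
    by (auto simp: parallelogram_iff)
  also have "\<dots> \<in> sets borel" by measurable
  finally show ?thesis .
qed

definition closed_parallelogram :: "complex set" where
  "closed_parallelogram = (\<lambda>(s, t). of_real s * \<omega>1 + of_real t * \<omega>2) ` ({0..1} \<times> {0..1})"

lemma compact_closed_parallelogram: "compact closed_parallelogram"
  unfolding closed_parallelogram_def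
  by (intro compact_continuous_image compact_Times)
     (auto simp: case_prod_unfold intro!: continuous_intros)

lemma parallelogram_subset: "P \<subseteq> closed_parallelogram"
proof
  fix z assume "z \<in> P"
  then show "z \<in> closed_parallelogram"
    unfolding closed_parallelogram_def parallelogram_iff
    using coord_expand[of z] by (intro image_eqI[of _ _ "(fst_coord z, snd_coord z)"]) auto
qed

lemma reduce_to_parallelogram: obtains \<omega> where "\<omega> \<in> \<Lambda>" "z + \<omega> \<in> P"
proof
  define \<omega> where "\<omega> = of_int (- \<lfloor>fst_coord z\<rfloor>) * \<omega>1 + of_int (- \<lfloor>snd_coord z\<rfloor>) * \<omega>2"
  show "\<omega> \<in> \<Lambda>" unfolding period_lattice_def \<omega>_def by blast
  show "z + \<omega> \<in> P" unfolding parallelogram_iff \<omega>_def coord_add coord_of_int coord_generators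
    by (simp; linarith)
qed

lemma periodicD: "lattice_periodic \<omega>1 \<omega>2 f \<Longrightarrow> \<omega> \<in> \<Lambda> \<Longrightarrow> f (z + \<omega>) = f z"
  by (simp add: lattice_periodic_def)

lemma continuous_periodic_bounded:
  fixes f :: "complex \<Rightarrow> real"
  assumes "continuous_on UNIV f" "lattice_periodic \<omega>1 \<omega>2 f"
  obtains B where "\<And>z. \<bar>f z\<bar> \<le> B"
proof -
  have "bounded (f ` closed_parallelogram)"
    using compact_continuous_image[OF continuous_on_subset[OF assms(1)] compact_closed_parallelogram]
    by (auto intro: compact_imp_bounded)
  then obtain B where B: "\<And>z. z \<in> closed_parallelogram \<Longrightarrow> \<bar>f z\<bar> \<le> B"
    by (auto simp: bounded_iff)
  have "\<bar>f z\<bar> \<le> B" for z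
  proof -
    obtain \<omega> where "\<omega> \<in> \<Lambda>" "z + \<omega> \<in> P" by (rule reduce_to_parallelogram)
    then show ?thesis using B[of "z + \<omega>"] parallelogram_subset periodicD[OF assms(2)] by auto
  qed
  then show ?thesis using that by blast
qed

abbreviation "torus_integrable \<equiv> set_integrable lborel P"
abbreviation "TI \<equiv> torus_integral \<omega>1 \<omega>2"

lemma continuous_torus_integrable:
  fixes f :: "complex \<Rightarrow> real"
  assumes "continuous_on UNIV f"
  shows "torus_integrable f"
proof (rule set_integrable_subset)
  show "set_integrable lborel closed_parallelogram f"
    unfolding set_integrable_def
    by (rule borel_integrable_compact[OF compact_closed_parallelogram])
       (use assms continuous_on_subset in blast)
qed (use parallelogram_subset in auto)

lemma integral_translation:
  fixes f :: "complex \<Rightarrow> real"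
  assumes "integrable lborel f"
  shows "integrable lborel (\<lambda>x. f (x + c))" "(LINT x|lborel. f (x + c)) = (LINT x|lborel. f x)"
proof -
  have m: "f \<in> borel_measurable borel" using borel_measurable_integrable[OF assms] by simp
  have "integrable (distr lborel borel ((+) c)) f" by (subst lborel_distr_plus) (rule assms)
  then have "integrable lborel (\<lambda>x. f (c + x))" by (rule integrable_distr[rotated]) auto
  then show "integrable lborel (\<lambda>x. f (x + c))" by (simp add: add.commute)
  have "(LINT x|distr lborel borel ((+) c). f x) = (LINT x|lborel. f (c + x))"
    by (rule integral_distr) (use m in auto)
  then show "(LINT x|lborel. f (x + c)) = (LINT x|lborel. f x)"
    by (simp add: lborel_distr_plus add.commute)
qed

text \<open>
  The translated parallelogram is cut by a line parallel to \<open>\<omega>2\<close> into two pieces. One of them lies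
  in the original parallelogram, and the other one is moved into the remaining part by the period
  \<open>\<omega>1\<close>.
\<close>
lemma torus_shift_fst_fraction:
  fixes f :: "complex \<Rightarrow> real"
  assumes f: "lattice_periodic \<omega>1 \<omega>2 f" "torus_integrable f" and \<alpha>: "0 \<le> \<alpha>" "\<alpha> < 1"
  shows "torus_integrable (\<lambda>z. f (z + of_real \<alpha> * \<omega>1)) \<and> TI (\<lambda>z. f (z + of_real \<alpha> * \<omega>1)) = TI f"
proof -
  define c where "c = of_real \<alpha> * \<omega>1"
  define d where "d = of_real (\<alpha> - 1) * \<omega>1"
  have cd: "c = d + \<omega>1" by (simp add: c_def d_def algebra_simps)
  have \<omega>1: "\<omega>1 \<in> \<Lambda>" by (simp add: lattice_iff)
  define A where "A = {z \<in> P. fst_coord z \<ge> \<alpha>}"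
  define B where "B = {z \<in> P. fst_coord z < \<alpha>}"
  have AB: "A \<in> sets borel" "B \<in> sets borel"
  proof -
    have "A = {z \<in> space borel. z \<in> P \<and> fst_coord z \<ge> \<alpha>}" "B = {z \<in> space borel. z \<in> P \<and> fst_coord z < \<alpha>}"
      by (auto simp: A_def B_def)
    moreover have "{z \<in> space borel. z \<in> P \<and> fst_coord z \<ge> \<alpha>} \<in> sets borel" by measurable
    moreover have "{z \<in> space borel. z \<in> P \<and> fst_coord z < \<alpha>} \<in> sets borel" by measurable
    ultimately show "A \<in> sets borel" "B \<in> sets borel" by auto
  qed
  have fA: "integrable lborel (\<lambda>z. indicator A z * f z)" and fB: "integrable lborel (\<lambda>z. indicator B z * f z)"
    using set_integrable_subset[OF f(2), of A] set_integrable_subset[OF f(2), of B] AB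
    by (auto simp: A_def B_def set_integrable_def)
  have split: "indicator P z * f (z + c)
      = indicator A (z + c) * f (z + c) + indicator B (z + d) * f (z + d)" for z
  proof -
    have "f (z + c) = f (z + d)" using periodicD[OF f(1) \<omega>1, of "z + d"] by (simp add: cd algebra_simps)
    moreover have "indicator P z = (indicator A (z + c) + indicator B (z + d) :: real)"
    proof -
      have "fst_coord c = \<alpha>" "snd_coord c = 0" "fst_coord d = \<alpha> - 1" "snd_coord d = 0"
        unfolding c_def d_def coord_of_real by simp_all
      then show ?thesis
        using \<alpha> by (auto simp: indicator_def A_def B_def parallelogram_iff)
    qed
    ultimately show ?thesis by (simp add: distrib_right)
  qed
  have "integrable lborel (\<lambda>z. indicator P z * f (z + c))"
    unfolding split by (intro Bochner_Integration.integrable_add integral_translation fA fB)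
  moreover have "(LINT z|lborel. indicator P z * f (z + c))
      = (LINT z|lborel. indicator A z * f z) + (LINT z|lborel. indicator B z * f z)"
    unfolding split integral_translation(2)[OF fA, symmetric, of c] integral_translation(2)[OF fB, symmetric, of d]
    by (intro Bochner_Integration.integral_add integral_translation fA fB)
  moreover have "(LINT z|lborel. indicator A z * f z) + (LINT z|lborel. indicator B z * f z)
      = (LINT z|lborel. indicator A z * f z + indicator B z * f z)"
    by (intro Bochner_Integration.integral_add[symmetric] fA fB)
  moreover have "(\<lambda>z. indicator A z * f z + indicator B z * f z) = (\<lambda>z. indicator P z * f z)"
    by (auto simp: A_def B_def indicator_def)
  ultimately show ?thesis
    unfolding torus_integral_def set_integrable_def set_lebesgue_integral_def c_def by simp
qed

lemma torus_shift_fst: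
  fixes f :: "complex \<Rightarrow> real"
  assumes f: "lattice_periodic \<omega>1 \<omega>2 f" "torus_integrable f"
  shows "torus_integrable (\<lambda>z. f (z + of_real \<alpha> * \<omega>1)) \<and> TI (\<lambda>z. f (z + of_real \<alpha> * \<omega>1)) = TI f"
proof -
  have "of_int \<lfloor>\<alpha>\<rfloor> * \<omega>1 \<in> \<Lambda>" by (simp add: lattice_iff)
  then have "f (z + of_real \<alpha> * \<omega>1) = f (z + of_real (frac \<alpha>) * \<omega>1)" for z
    using periodicD[OF f(1), of "of_int \<lfloor>\<alpha>\<rfloor> * \<omega>1" "z + of_real (frac \<alpha>) * \<omega>1"]
    by (simp add: frac_def algebra_simps)
  then show ?thesis using torus_shift_fst_fraction[OF f, of "frac \<alpha>"] by (simp add: frac_lt_1)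
qed

end

lemma period_lattice_swap: "period_lattice a b = period_lattice b a"
  unfolding period_lattice_def by (rule Collect_cong) (metis add.commute)

lemma fundamental_parallelogram_swap: "fundamental_parallelogram a b = fundamental_parallelogram b a"
  unfolding fundamental_parallelogram_def by (rule Collect_cong) (metis add.commute)

context complex_lattice
begin

lemma lattice_periodic_shift:
  assumes "lattice_periodic \<omega>1 \<omega>2 f"
  shows "lattice_periodic \<omega>1 \<omega>2 (\<lambda>z. f (z + c))"
  unfolding lattice_periodic_def
proof (intro allI ballI)
  fix z \<omega> assume "\<omega> \<in> \<Lambda>"
  then show "f (z + \<omega> + c) = f (z + c)"
    using periodicD[OF assms, of \<omega> "z + c"] by (simp add: add.assoc add.commute[of \<omega> c])
qed

text \<open>
  A translation is the composition of translations along the two generators; the second one is the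
  first one after exchanging the generators.
\<close>
lemma torus_shift:
  fixes f :: "complex \<Rightarrow> real"
  assumes f: "lattice_periodic \<omega>1 \<omega>2 f" "torus_integrable f"
  shows "torus_integrable (\<lambda>z. f (z + c))" "TI (\<lambda>z. f (z + c)) = TI f"
proof -
  interpret swap: complex_lattice \<omega>2 \<omega>1
    using cross_nonzero by unfold_locales (simp add: algebra_simps)
  define g where "g = (\<lambda>z. f (z + of_real (fst_coord c) * \<omega>1))"
  have g: "lattice_periodic \<omega>1 \<omega>2 g" "torus_integrable g" "TI g = TI f"
    unfolding g_def using torus_shift_fst[OF f] lattice_periodic_shift[OF f(1)] by auto
  have "torus_integrable (\<lambda>z. g (z + of_real (snd_coord c) * \<omega>2))
      \<and> TI (\<lambda>z. g (z + of_real (snd_coord c) * \<omega>2)) = TI g"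
    using swap.torus_shift_fst[of g "snd_coord c"] g
    by (simp add: lattice_periodic_def torus_integral_def period_lattice_swap[of \<omega>2 \<omega>1]
         fundamental_parallelogram_swap[of \<omega>2 \<omega>1])
  moreover have "g (z + of_real (snd_coord c) * \<omega>2) = f (z + c)" for z
    using coord_expand[of c] by (simp add: g_def algebra_simps)
  ultimately show "torus_integrable (\<lambda>z. f (z + c))" "TI (\<lambda>z. f (z + c)) = TI f"
    using g(3) by auto
qed

lemma lattice_periodic_dir_deriv:
  assumes "lattice_periodic \<omega>1 \<omega>2 f" "\<And>z. f differentiable (at z)"
  shows "lattice_periodic \<omega>1 \<omega>2 (dir_deriv v f)"
  unfolding lattice_periodic_def
proof (intro allI ballI)
  fix z \<omega> assume \<omega>: "\<omega> \<in> \<Lambda>"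
  have "(f has_derivative frechet_derivative f (at (z + \<omega>))) (at (z + \<omega>))"
    using assms(2) frechet_derivative_works by blast
  moreover have "((\<lambda>x. x + \<omega>) has_derivative (\<lambda>h. h)) (at z)" by (auto intro!: derivative_eq_intros)
  ultimately have "((\<lambda>x. f (x + \<omega>)) has_derivative (\<lambda>h. frechet_derivative f (at (z + \<omega>)) h)) (at z)"
    by (rule has_derivative_compose[rotated])
  then have "(f has_derivative (\<lambda>h. frechet_derivative f (at (z + \<omega>)) h)) (at z)"
    using periodicD[OF assms(1) \<omega>] by simp
  from dir_deriv_eqI[OF this, of v] show "dir_deriv v f (z + \<omega>) = dir_deriv v f z"
    by (simp add: dir_deriv_def)
qed

lemma torus_integral_diff:
  assumes "torus_integrable f" "torus_integrable g"
  shows "TI (\<lambda>z. f z - g z) = TI f - TI g"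
  unfolding torus_integral_def using set_integral_diff(2)[OF assms] .

lemma torus_integral_add:
  assumes "torus_integrable f" "torus_integrable g"
  shows "TI (\<lambda>z. f z + g z) = TI f + TI g"
  unfolding torus_integral_def using set_integral_add(2)[OF assms] .

text \<open>
  By translation invariance every difference quotient has integral \<open>0\<close>. The difference quotients
  are dominated by the supremum of the derivative, so the limit may be taken under the integral.
\<close>
lemma torus_integral_dir_deriv_0:
  assumes per: "lattice_periodic \<omega>1 \<omega>2 f" and diff: "\<And>z. f differentiable (at z)"
    and cont: "continuous_on UNIV (dir_deriv v f)"
  shows "TI (dir_deriv v f) = 0"
proof -
  define D where "D = (\<lambda>n z. (f (z + of_real (1 / real (Suc n)) * v) - f z) * real (Suc n))"
  obtain B where B: "\<And>z. \<bar>dir_deriv v f z\<bar> \<le> B"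
    using continuous_periodic_bounded[OF cont lattice_periodic_dir_deriv[OF per diff]] by blast
  have line: "((\<lambda>t. f (z + of_real t * v)) has_real_derivative dir_deriv v f (z + of_real t * v)) (at t)"
    for z t
  proof -
    have "(f has_derivative frechet_derivative f (at (z + of_real t * v))) (at (z + of_real t * v))"
      using diff frechet_derivative_works by blast
    moreover have "((\<lambda>t. z + of_real t * v) has_derivative (\<lambda>h. of_real h * v)) (at t)"
      by (auto intro!: derivative_eq_intros)
    ultimately have d: "((\<lambda>t. f (z + of_real t * v)) has_derivative
        (\<lambda>h. frechet_derivative f (at (z + of_real t * v)) (of_real h * v))) (at t)"
      by (rule has_derivative_compose[rotated])
    have "frechet_derivative f (at (z + of_real t * v)) (of_real h * v)
        = (*) (dir_deriv v f (z + of_real t * v)) h" for h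
    proof -
      have "linear (frechet_derivative f (at (z + of_real t * v)))" by (rule linear_frechet_derivative[OF diff])
      from linear_scale[OF this, of h v] show ?thesis
        by (simp add: dir_deriv_def scaleR_conv_of_real mult.commute)
    qed
    then show ?thesis using d unfolding has_field_derivative_def by (simp only:)
  qed
  have D_int: "torus_integrable (D n)" "TI (D n) = 0" for n
  proof -
    have fi: "torus_integrable f"
      by (rule continuous_torus_integrable)
         (use diff in \<open>auto intro!: continuous_at_imp_continuous_on differentiable_imp_continuous_within\<close>)
    note s = torus_shift[OF per fi, of "of_real (1 / real (Suc n)) * v"]
    have "torus_integrable (\<lambda>z. f (z + of_real (1 / real (Suc n)) * v) - f z)"
      by (rule set_integral_diff(1)[OF s(1) fi])
    then show "torus_integrable (D n)" unfolding D_def by (rule set_integrable_mult_left)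
    have "TI (D n) = TI (\<lambda>z. f (z + of_real (1 / real (Suc n)) * v) - f z) * real (Suc n)"
      by (simp only: D_def torus_integral_def set_integral_mult_left)
    then show "TI (D n) = 0" using torus_integral_diff[OF s(1) fi] s(2) by simp
  qed
  have lim: "(\<lambda>n. D n z) \<longlonglongrightarrow> dir_deriv v f z" for z
  proof -
    have "((\<lambda>h. (f (z + of_real h * v) - f z) / h) \<longlongrightarrow> dir_deriv v f z) (at 0)"
      using line[of z 0] unfolding DERIV_def by simp
    moreover have "filterlim (\<lambda>n. 1 / real (Suc n)) (at 0) sequentially"
      using LIMSEQ_inverse_real_of_nat unfolding filterlim_at by (simp add: divide_inverse)
    ultimately have "(\<lambda>n. (f (z + of_real (1 / real (Suc n)) * v) - f z) / (1 / real (Suc n))) \<longlonglongrightarrow> dir_deriv v f z"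
      by (rule filterlim_compose)
    then show ?thesis by (simp add: D_def)
  qed
  have bound: "\<bar>D n z\<bar> \<le> B" for n z
  proof -
    have "0 < 1 / real (Suc n)" by simp
    from MVT2[OF this line[of z]]
    obtain t where "f (z + of_real (1 / real (Suc n)) * v) - f (z + of_real 0 * v)
        = (1 / real (Suc n) - 0) * dir_deriv v f (z + of_real t * v)"
      by (elim exE conjE)
    then have "D n z = dir_deriv v f (z + of_real t * v)" by (simp add: D_def del: of_nat_Suc)
    then show ?thesis using B by simp
  qed
  have "(\<lambda>n. LINT z|lborel. indicator P z * D n z) \<longlonglongrightarrow> (LINT z|lborel. indicator P z * dir_deriv v f z)"
  proof (rule integral_dominated_convergence[where w = "\<lambda>z. indicator P z * B"])
    show "integrable lborel (\<lambda>z. indicator P z * B)"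
      using continuous_torus_integrable[of "\<lambda>_. B"] by (simp add: set_integrable_def)
    show "(\<lambda>z. indicator P z * dir_deriv v f z) \<in> borel_measurable lborel"
      using continuous_torus_integrable[OF cont] unfolding set_integrable_def
      by (auto dest: borel_measurable_integrable)
    show "(\<lambda>z. indicator P z * D n z) \<in> borel_measurable lborel" for n
      using D_int(1)[of n] unfolding set_integrable_def by (auto dest: borel_measurable_integrable)
    show "AE z in lborel. (\<lambda>n. indicator P z * D n z) \<longlonglongrightarrow> indicator P z * dir_deriv v f z"
      using lim by (auto intro!: AE_I2 tendsto_intros)
    show "AE z in lborel. norm (indicator P z * D n z) \<le> indicator P z * B" for n
    proof (rule AE_I2)
      fix z show "norm (indicator P z * D n z) \<le> indicator P z * B"
        using bound[of n z] by (cases "z \<in> P") simp_all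
    qed
  qed
  moreover have "(\<lambda>n. LINT z|lborel. indicator P z * D n z) = (\<lambda>_. 0)"
    using D_int(2) by (simp add: torus_integral_def set_lebesgue_integral_def)
  ultimately have "(LINT z|lborel. indicator P z * dir_deriv v f z) = 0"
    by (simp add: LIMSEQ_const_iff)
  then show ?thesis by (simp add: torus_integral_def set_lebesgue_integral_def)
qed

lemma torus_integral_laplacian_0:
  assumes "smooth_fun f" "lattice_periodic \<omega>1 \<omega>2 f"
  shows "TI (laplacian f) = 0"
proof -
  have diff: "foldr dir_deriv vs f differentiable (at z)" if "vs \<in> lists {1, \<i>}" for vs z
    using assms(1) that by (simp add: smooth_fun_def)
  have cont: "continuous_on UNIV (foldr dir_deriv vs f)" if "vs \<in> lists {1, \<i>}" for vs
    using diff[OF that] by (auto intro!: continuous_at_imp_continuous_on differentiable_imp_continuous_within)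
  have *: "TI (dir_deriv v (dir_deriv v f)) = 0" "torus_integrable (dir_deriv v (dir_deriv v f))"
    if v: "v \<in> {1, \<i>}" for v
  proof -
    have l: "[v] \<in> lists {1, \<i>}" "[v, v] \<in> lists {1, \<i>}" using v by auto
    have "lattice_periodic \<omega>1 \<omega>2 (dir_deriv v f)"
      using lattice_periodic_dir_deriv[OF assms(2)] diff[of "[]"] by simp
    then show "TI (dir_deriv v (dir_deriv v f)) = 0"
      using torus_integral_dir_deriv_0 diff[OF l(1)] cont[OF l(2)] by simp
    show "torus_integrable (dir_deriv v (dir_deriv v f))"
      using continuous_torus_integrable[OF cont[OF l(2)]] by simp
  qed
  have "TI (laplacian f) = TI (\<lambda>z. dir_deriv 1 (dir_deriv 1 f) z + dir_deriv \<i> (dir_deriv \<i> f) z)"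
    by (simp add: laplacian_def[abs_def])
  also have "\<dots> = 0" using torus_integral_add[OF *(2) *(2)] *(1) by simp
  finally show ?thesis .
qed

text \<open>
  Near \<open>q\<close> and its translates \<open>K\<close> is close to \<open>K q\<close> by continuity and periodicity, and the density has
  mass at most \<open>M\<close>; elsewhere the densities tend to \<open>0\<close> uniformly, while \<open>K\<close> is integrable.
\<close>
lemma torus_integral_concentrated:
  fixes m :: "nat \<Rightarrow> complex \<Rightarrow> real"
  assumes K: "torus_integrable K" "lattice_periodic \<omega>1 \<omega>2 K" "isCont K q"
    and m: "\<And>n. continuous_on UNIV (m n)" "\<And>n. lattice_periodic \<omega>1 \<omega>2 (m n)" "\<And>n z. m n z \<ge> 0"
      "\<And>n. TI (m n) = M"
    and away: "\<And>\<delta>. \<delta> > 0 \<Longrightarrow> \<exists>S. S \<longlonglongrightarrow> 0 \<and> (\<forall>n z. (\<forall>\<omega>\<in>\<Lambda>. dist z (q + \<omega>) \<ge> \<delta>) \<longrightarrow> m n z \<le> S n)"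
  shows "torus_integrable (\<lambda>z. K z * m n z)" "(\<lambda>n. TI (\<lambda>z. K z * m n z)) \<longlonglongrightarrow> M * K q"
proof -
  have int: "torus_integrable (\<lambda>z. f z * m n z)" if "torus_integrable f" for n f
  proof -
    obtain B where B: "\<And>z. \<bar>m n z\<bar> \<le> B"
      by (rule continuous_periodic_bounded[OF m(1)[of n] m(2)[of n]]) (rule that)
    show ?thesis
    proof (rule set_integrable_bound)
      show "torus_integrable (\<lambda>z. f z * B)" using that by simp
      have "(\<lambda>z. indicator P z * f z) \<in> borel_measurable lborel"
        using that unfolding set_integrable_def by (auto dest: borel_measurable_integrable)
      moreover have "m n \<in> borel_measurable lborel"
        using m(1) by (auto intro: borel_measurable_continuous_onI)
      ultimately have "(\<lambda>z. (indicator P z * f z) * m n z) \<in> borel_measurable lborel" by simp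
      then show "set_borel_measurable lborel P (\<lambda>z. f z * m n z)"
        by (simp add: set_borel_measurable_def mult.assoc)
      show "AE z in lborel. z \<in> P \<longrightarrow> norm (f z * m n z) \<le> norm (f z * B)"
        unfolding real_norm_def abs_mult
        by (intro AE_I2 impI mult_left_mono order_trans[OF B abs_ge_self] abs_ge_zero)
    qed
  qed
  then show "torus_integrable (\<lambda>z. K z * m n z)" for n using K(1) .
  define L where "L = (\<lambda>z. K z - K q)"
  have const: "torus_integrable (\<lambda>_. c)" for c :: real by (rule continuous_torus_integrable) simp
  have mi: "torus_integrable (m n)" for n by (rule continuous_torus_integrable[OF m(1)])
  have L: "torus_integrable L" unfolding L_def by (rule set_integral_diff(1)[OF K(1) const])
  have Labs: "torus_integrable (\<lambda>z. \<bar>L z\<bar>)" using set_integrable_abs[OF L] .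
  have M0: "M \<ge> 0"
  proof -
    have "0 \<le> TI (m 0)"
      unfolding torus_integral_def set_lebesgue_integral_def
      by (intro integral_nonneg_AE AE_I2) (simp add: m(3))
    then show ?thesis by (simp only: m(4))
  qed
  have "(\<lambda>n. TI (\<lambda>z. L z * m n z)) \<longlonglongrightarrow> 0"
  proof (rule LIMSEQ_I)
    fix e :: real assume e: "e > 0"
    \<comment> \<open>The denominator \<open>M + 1\<close> instead of \<open>M\<close> covers the case \<open>M = 0\<close>.\<close>
    define \<eta> where "\<eta> = e / (2 * (M + 1))"
    have \<eta>: "\<eta> > 0" "\<eta> * M < e / 2"
      using e M0 by (auto simp: \<eta>_def field_simps add_pos_nonneg)
    obtain \<delta> where \<delta>: "\<delta> > 0" "\<And>z. dist z q < \<delta> \<Longrightarrow> dist (K z) (K q) < \<eta>"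
      using K(3) \<eta>(1) unfolding continuous_at_eps_delta by blast
    obtain S where S: "S \<longlonglongrightarrow> 0" "\<And>n z. (\<forall>\<omega>\<in>\<Lambda>. dist z (q + \<omega>) \<ge> \<delta>) \<Longrightarrow> m n z \<le> S n"
      using away[OF \<delta>(1)] by blast
    have pw: "\<bar>L z * m n z\<bar> \<le> \<eta> * m n z + \<bar>S n\<bar> * \<bar>L z\<bar>" for n z
    proof (cases "\<forall>\<omega>\<in>\<Lambda>. dist z (q + \<omega>) \<ge> \<delta>")
      case True
      then have "\<bar>L z\<bar> * m n z \<le> \<bar>L z\<bar> * \<bar>S n\<bar>" using S(2)[of z n] by (intro mult_left_mono) auto
      moreover have "\<eta> * m n z \<ge> 0" using \<eta> m(3) by simp
      ultimately show ?thesis using m(3)[of n z] by (simp add: abs_mult mult.commute)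
    next
      case False
      then obtain \<omega> where \<omega>: "\<omega> \<in> \<Lambda>" "dist z (q + \<omega>) < \<delta>" by auto
      then have "dist (z + - \<omega>) q < \<delta>" by (simp add: dist_norm algebra_simps)
      then have "dist (K (z + - \<omega>)) (K q) < \<eta>" using \<delta>(2) by blast
      then have "\<bar>L z\<bar> \<le> \<eta>"
        using periodicD[OF K(2) lattice_minus[OF \<omega>(1)], of z] by (simp add: L_def dist_real_def)
      then have "\<bar>L z\<bar> * m n z \<le> \<eta> * m n z" using m(3) by (intro mult_right_mono)
      moreover have "\<bar>S n\<bar> * \<bar>L z\<bar> \<ge> 0" by simp
      moreover have "\<bar>L z * m n z\<bar> = \<bar>L z\<bar> * m n z" using m(3)[of n z] by (simp add: abs_mult)
      ultimately show ?thesis by linarith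
    qed
    have bd: "\<bar>TI (\<lambda>z. L z * m n z)\<bar> \<le> \<eta> * M + \<bar>S n\<bar> * TI (\<lambda>z. \<bar>L z\<bar>)" for n
    proof -
      have i1: "torus_integrable (\<lambda>z. \<eta> * m n z)" "torus_integrable (\<lambda>z. \<bar>S n\<bar> * \<bar>L z\<bar>)"
        using mi Labs by auto
      have "\<bar>TI (\<lambda>z. L z * m n z)\<bar> \<le> TI (\<lambda>z. \<bar>L z * m n z\<bar>)"
        unfolding torus_integral_def using set_integral_norm_bound[OF int[OF L, of n]] by simp
      also have "\<dots> \<le> TI (\<lambda>z. \<eta> * m n z + \<bar>S n\<bar> * \<bar>L z\<bar>)"
        unfolding torus_integral_def
        by (rule set_integral_mono) (use set_integrable_abs[OF int[OF L]] set_integral_add(1)[OF i1] pw in auto)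
      also have "\<dots> = \<eta> * M + \<bar>S n\<bar> * TI (\<lambda>z. \<bar>L z\<bar>)"
        unfolding torus_integral_add[OF i1] m(4)[of n, symmetric] by (simp add: torus_integral_def)
      finally show ?thesis .
    qed
    have "(\<lambda>n. \<bar>S n\<bar> * TI (\<lambda>z. \<bar>L z\<bar>)) \<longlonglongrightarrow> \<bar>0\<bar> * TI (\<lambda>z. \<bar>L z\<bar>)"
      using S(1) by (intro tendsto_intros)
    then have "eventually (\<lambda>n. \<bar>S n\<bar> * TI (\<lambda>z. \<bar>L z\<bar>) < e / 2) sequentially"
      using e by (intro order_tendstoD(2)) auto
    then obtain N where "\<And>n. n \<ge> N \<Longrightarrow> \<bar>S n\<bar> * TI (\<lambda>z. \<bar>L z\<bar>) < e / 2"
      unfolding eventually_sequentially by blast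
    then show "\<exists>no. \<forall>n\<ge>no. norm (TI (\<lambda>z. L z * m n z) - 0) < e"
    proof (intro exI[of _ N] allI impI)
      fix n assume "n \<ge> N"
      then have "\<bar>S n\<bar> * TI (\<lambda>z. \<bar>L z\<bar>) < e / 2" by fact
      then have "\<bar>TI (\<lambda>z. L z * m n z)\<bar> < e" using bd[of n] \<eta>(2) by linarith
      then show "norm (TI (\<lambda>z. L z * m n z) - 0) < e" by simp
    qed
  qed
  moreover have "TI (\<lambda>z. K z * m n z) = TI (\<lambda>z. L z * m n z) + M * K q" for n
  proof -
    have "TI (\<lambda>z. K z * m n z) = TI (\<lambda>z. L z * m n z + K q * m n z)"
      by (simp add: L_def algebra_simps)
    also have "\<dots> = TI (\<lambda>z. L z * m n z) + TI (\<lambda>z. K q * m n z)"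
      using int[OF L] mi by (intro torus_integral_add) auto
    also have "TI (\<lambda>z. K q * m n z) = M * K q"
      unfolding m(4)[of n, symmetric] by (simp add: torus_integral_def)
    finally show ?thesis .
  qed
  ultimately show "(\<lambda>n. TI (\<lambda>z. K z * m n z)) \<longlonglongrightarrow> M * K q"
    using tendsto_add[OF _ tendsto_const, of _ 0 sequentially "M * K q"] by simp
qed

end

section \<open>The Weierstrass function\<close>

lemma summable_on_int_powr: "(\<lambda>m::int. (1 + \<bar>real_of_int m\<bar>) powr (-3/2)) summable_on UNIV"
proof -
  have "summable (\<lambda>n. real n powr (-3/2))" by (subst summable_real_powr_iff) simp
  then have "summable (\<lambda>n. real (Suc n) powr (-3/2))" by (subst summable_Suc_iff)
  then have nat: "(\<lambda>n. (1 + real n) powr (-3/2)) summable_on UNIV"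
    by (subst summable_on_UNIV_nonneg_real_iff) (simp_all add: add.commute)
  have "(\<lambda>m::int. (1 + \<bar>real_of_int m\<bar>) powr (-3/2)) summable_on range int"
    "(\<lambda>m::int. (1 + \<bar>real_of_int m\<bar>) powr (-3/2)) summable_on range (\<lambda>n. - int n)"
    by (subst summable_on_reindex; use nat in \<open>simp add: inj_on_def o_def\<close>)+
  then have "(\<lambda>m::int. (1 + \<bar>real_of_int m\<bar>) powr (-3/2)) summable_on (range int \<union> range (\<lambda>n. - int n))"
    by (rule summable_on_union)
  moreover have "range int \<union> range (\<lambda>n. - int n) = UNIV"
    by (auto simp: image_iff) (metis int_cases2)
  ultimately show ?thesis by simp
qed

text \<open>
  An even function has a vanishing derivative at \<open>0\<close>, so a zero there is at least double.
\<close>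
lemma even_zero_quotient_limit:
  assumes "open U" "0 \<in> U" "f holomorphic_on U" "f 0 = 0" "\<And>z. f (- z) = f z"
  shows "\<exists>l. (\<lambda>z. f z / z\<^sup>2) \<midarrow>0\<rightarrow> l"
proof -
  define g where "g = (\<lambda>z. if z = 0 then deriv f 0 else (f z - f 0) / (z - 0))"
  define h where "h = (\<lambda>z. if z = 0 then deriv g 0 else (g z - g 0) / (z - 0))"
  have g: "g holomorphic_on U" unfolding g_def by (rule pole_lemma_open[OF assms(3,1)])
  have h: "h holomorphic_on U" unfolding h_def by (rule pole_lemma_open[OF g assms(1)])
  have gz: "g \<midarrow>0\<rightarrow> g 0"
    using holomorphic_on_imp_continuous_on[OF g] assms(1,2) continuous_on_eq_continuous_at isCont_def by blast
  have "g 0 = 0"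
  proof -
    have "(\<lambda>z. g (- z)) \<midarrow>0\<rightarrow> g 0"
      by (rule filterlim_compose[OF gz]) (auto simp: filterlim_at eventually_at_filter intro!: tendsto_eq_intros)
    then have "(\<lambda>z. - g z) \<midarrow>0\<rightarrow> g 0"
      by (rule Lim_transform_eventually) (simp add: eventually_at_filter g_def assms(4,5))
    then have "- g 0 = g 0" using tendsto_minus[OF gz] LIM_unique by blast
    then show ?thesis by simp
  qed
  have "h \<midarrow>0\<rightarrow> h 0"
    using holomorphic_on_imp_continuous_on[OF h] assms(1,2) continuous_on_eq_continuous_at isCont_def by blast
  moreover have "h z = f z / z\<^sup>2" if "z \<noteq> 0" for z
    using that \<open>g 0 = 0\<close> assms(4) by (simp add: h_def g_def power2_eq_square)
  then have "eventually (\<lambda>z. h z = f z / z\<^sup>2) (at 0)" by (simp add: eventually_at_filter)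
  ultimately have "(\<lambda>z. f z / z\<^sup>2) \<midarrow>0\<rightarrow> h 0"
    by (rule Lim_transform_eventually)
  then show ?thesis by blast
qed

context complex_lattice
begin

lemma lattice_separated: "\<exists>\<delta>>0. \<forall>\<omega>\<in>\<Lambda>. \<omega> \<noteq> 0 \<longrightarrow> norm \<omega> \<ge> \<delta>"
proof -
  obtain C where C: "C > 0" "\<And>z. \<bar>fst_coord z\<bar> \<le> C * norm z" "\<And>z. \<bar>snd_coord z\<bar> \<le> C * norm z"
    using coord_bound by blast
  have "norm \<omega> \<ge> 1 / C" if \<omega>: "\<omega> \<in> \<Lambda>" "\<omega> \<noteq> 0" for \<omega>
  proof -
    have "fst_coord \<omega> \<noteq> 0 \<or> snd_coord \<omega> \<noteq> 0" using coord_expand[of \<omega>] \<omega>(2) by auto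
    then have "\<bar>fst_coord \<omega>\<bar> \<ge> 1 \<or> \<bar>snd_coord \<omega>\<bar> \<ge> 1"
      using \<omega>(1) unfolding lattice_iff by (auto elim!: Ints_cases)
    then have "C * norm \<omega> \<ge> 1" using C(2,3)[of \<omega>] by linarith
    then show ?thesis using C(1) by (simp add: field_simps)
  qed
  then show ?thesis using C(1) by (intro exI[of _ "1 / C"]) simp
qed

text \<open>
  The singularities to be removed by Liouville's theorem all lie in the half lattice. Its subsets are
  closed because its points keep a uniform distance.
\<close>
lemma closed_half_lattice_subset:
  assumes "\<And>z. z \<in> S \<Longrightarrow> 2 * z \<in> \<Lambda>"
  shows "closed S"
proof -
  obtain \<delta> where \<delta>: "\<delta> > 0" "\<And>\<omega>. \<omega> \<in> \<Lambda> \<Longrightarrow> \<omega> \<noteq> 0 \<Longrightarrow> norm \<omega> \<ge> \<delta>"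
    using lattice_separated by blast
  show ?thesis
  proof (rule discrete_imp_closed)
    show "\<forall>x\<in>S. \<forall>y\<in>S. dist y x < \<delta> / 2 \<longrightarrow> y = x"
    proof (intro ballI impI)
      fix x y assume xy: "x \<in> S" "y \<in> S" "dist y x < \<delta> / 2"
      have "2 * y - 2 * x \<in> \<Lambda>" by (intro lattice_diff assms xy)
      moreover have "norm (2 * y - 2 * x) < \<delta>"
        using xy(3) norm_mult[of 2 "y - x"] by (simp add: dist_norm algebra_simps)
      ultimately have "2 * y - 2 * x = 0" using \<delta>(2)[of "2 * y - 2 * x"] by (metis not_le)
      then show "y = x" by simp
    qed
    show "0 < \<delta> / 2" using \<delta>(1) by simp
  qed
qed

lemma lattice_double: "\<omega> \<in> \<Lambda> \<Longrightarrow> 2 * \<omega> \<in> \<Lambda>"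
  unfolding mult_2 by (rule lattice_add)

lemma closed_lattice_subset: "S \<subseteq> \<Lambda> \<Longrightarrow> closed S"
  by (rule closed_half_lattice_subset) (rule lattice_double, rule subsetD)

lemma finite_lattice_ball: "finite {\<omega> \<in> \<Lambda>. norm \<omega> \<le> r}"
proof -
  obtain C where C: "C > 0" "\<And>z. \<bar>fst_coord z\<bar> \<le> C * norm z" "\<And>z. \<bar>snd_coord z\<bar> \<le> C * norm z"
    using coord_bound by blast
  define N where "N = \<lceil>C * r\<rceil>"
  have "{\<omega> \<in> \<Lambda>. norm \<omega> \<le> r} \<subseteq> (\<lambda>(m, n). of_int m * \<omega>1 + of_int n * \<omega>2) ` ({-N..N} \<times> {-N..N})"
  proof
    fix \<omega> assume *: "\<omega> \<in> {\<omega> \<in> \<Lambda>. norm \<omega> \<le> r}"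
    then obtain m n where mn: "\<omega> = of_int m * \<omega>1 + of_int n * \<omega>2" by (auto simp: period_lattice_def)
    have "C * norm \<omega> \<le> C * r" using * C(1) by (intro mult_left_mono) auto
    then have "\<bar>real_of_int m\<bar> \<le> C * r" "\<bar>real_of_int n\<bar> \<le> C * r"
      using C(2)[of \<omega>] C(3)[of \<omega>] by (simp_all add: mn)
    then have "\<bar>m\<bar> \<le> N" "\<bar>n\<bar> \<le> N" unfolding N_def by linarith+
    then show "\<omega> \<in> (\<lambda>(m, n). of_int m * \<omega>1 + of_int n * \<omega>2) ` ({-N..N} \<times> {-N..N})"
      using mn by (intro image_eqI[of _ _ "(m, n)"]) (simp_all add: abs_le_iff)
  qed
  then show ?thesis by (rule finite_subset) simp
qed

text \<open>
  For coordinates \<open>m, n\<close> of a nonzero lattice point, both \<open>1 + |m|\<close> and \<open>1 + |n|\<close> are bounded by a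
  multiple of its norm \<open>r\<close>. Hence \<open>((1 + |m|) (1 + |n|))\<^sup>3\<^sup>/\<^sup>2\<close> is bounded by a multiple of \<open>r\<^sup>3\<close>, and
  the comparison series is a product of two convergent series in one variable.
\<close>
lemma summable_on_lattice_inverse_cube: "(\<lambda>\<omega>. 1 / norm \<omega> ^ 3) summable_on \<Lambda>"
proof -
  obtain C where C: "C > 0" "\<And>z. \<bar>fst_coord z\<bar> \<le> C * norm z" "\<And>z. \<bar>snd_coord z\<bar> \<le> C * norm z"
    using coord_bound by blast
  define g where "g = (\<lambda>m::int. (1 + \<bar>real_of_int m\<bar>) powr (-3/2))"
  have g: "g summable_on UNIV" unfolding g_def by (rule summable_on_int_powr)
  have "(\<lambda>p. g (fst p) * g (snd p)) summable_on (UNIV \<times> UNIV)"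
  proof (rule summable_on_SigmaI)
    show "((\<lambda>y. g (fst (x, y)) * g (snd (x, y))) has_sum (g x * infsum g UNIV)) UNIV" for x
      unfolding fst_conv snd_conv by (intro has_sum_cmult_right has_sum_infsum g)
    show "(\<lambda>x. g x * infsum g UNIV) summable_on UNIV" by (intro summable_on_cmult_left g)
  qed (simp add: g_def)
  then have sum: "(\<lambda>p. (2 * C) ^ 3 * (g (fst p) * g (snd p))) summable_on UNIV"
    unfolding UNIV_Times_UNIV by (rule summable_on_cmult_right)
  define e where "e = (\<lambda>p. of_int (fst p) * \<omega>1 + of_int (snd p) * \<omega>2 :: complex)"
  have bound: "1 / norm (e p) ^ 3 \<le> (2 * C) ^ 3 * (g (fst p) * g (snd p))" for p
  proof (cases "e p = 0")
    case True
    then show ?thesis using C(1) by (simp add: g_def)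
  next
    case False
    define x where "x = norm (e p)"
    define a where "a = 1 + \<bar>real_of_int (fst p)\<bar>"
    define b where "b = 1 + \<bar>real_of_int (snd p)\<bar>"
    have x: "x > 0" using False by (simp add: x_def)
    have ab: "\<bar>real_of_int (fst p)\<bar> \<le> C * x" "\<bar>real_of_int (snd p)\<bar> \<le> C * x"
      using C(2)[of "e p"] C(3)[of "e p"] by (simp_all add: e_def x_def)
    have "fst p \<noteq> 0 \<or> snd p \<noteq> 0" using False by (auto simp: e_def)
    then have "\<bar>real_of_int (fst p)\<bar> \<ge> 1 \<or> \<bar>real_of_int (snd p)\<bar> \<ge> 1" by linarith
    then have "C * x \<ge> 1" using ab by linarith
    then have "a \<le> 2 * C * x" "b \<le> 2 * C * x" using ab by (auto simp: a_def b_def)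
    then have "(a * b) powr (3/2) \<le> ((2 * C * x) * (2 * C * x)) powr (3/2)"
      by (intro powr_mono2 mult_mono) (auto simp: a_def b_def)
    also have "\<dots> = (2 * C * x) ^ 3"
    proof -
      have "((2 * C * x) * (2 * C * x)) powr (3/2) = ((2 * C * x) powr 2) powr (3/2)"
        using x C(1) by (simp add: powr_numeral power2_eq_square)
      also have "\<dots> = (2 * C * x) powr 3" by (simp add: powr_powr)
      finally show ?thesis using x C(1) by (simp add: powr_numeral)
    qed
    finally have le: "(a * b) powr (3/2) \<le> (2 * C) ^ 3 * x ^ 3" by (simp add: power_mult_distrib)
    have "a > 0" "b > 0" unfolding a_def b_def by (auto intro: add_pos_nonneg)
    then have pos: "(a * b) powr (3/2) > 0" by simp
    have "g (fst p) = a powr (- (3/2))" "g (snd p) = b powr (- (3/2))"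
      unfolding g_def a_def b_def minus_divide_left by (rule refl)+
    then have "g (fst p) * g (snd p) = (a * b) powr (- (3/2))"
      by (simp only: powr_mult)
    then have "g (fst p) * g (snd p) = 1 / (a * b) powr (3/2)" by (simp only: powr_minus_divide)
    moreover have "1 / x ^ 3 \<le> (2 * C) ^ 3 * (1 / (a * b) powr (3/2))"
    proof -
      have "1 / x ^ 3 = (2 * C) ^ 3 * (1 / ((2 * C) ^ 3 * x ^ 3))" using C(1) x by simp
      also have "\<dots> \<le> (2 * C) ^ 3 * (1 / (a * b) powr (3/2))"
        using le pos C(1) by (intro mult_left_mono divide_left_mono mult_pos_pos zero_less_power) (auto simp: x)
      finally show ?thesis .
    qed
    ultimately show ?thesis by (simp add: x_def)
  qed
  have "(\<lambda>p. 1 / norm (e p) ^ 3) summable_on UNIV"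
    by (rule summable_on_comparison_test[OF sum bound]) simp
  moreover have "inj e"
  proof (rule injI)
    fix p q assume "e p = e q"
    then have "fst_coord (e p) = fst_coord (e q)" "snd_coord (e p) = snd_coord (e q)" by simp_all
    then show "p = q" by (simp add: e_def prod_eq_iff)
  qed
  moreover have "range e = \<Lambda>"
  proof
    show "range e \<subseteq> \<Lambda>" by (auto simp: e_def period_lattice_def)
    show "\<Lambda> \<subseteq> range e"
    proof
      fix \<omega> assume "\<omega> \<in> \<Lambda>"
      then obtain m n where "\<omega> = of_int m * \<omega>1 + of_int n * \<omega>2" by (auto simp: period_lattice_def)
      then have "\<omega> = e (m, n)" by (simp add: e_def)
      then show "\<omega> \<in> range e" by blast
    qed
  qed
  ultimately show ?thesis
    using summable_on_reindex[of e UNIV "\<lambda>\<omega>. 1 / norm \<omega> ^ 3"] unfolding o_def by metis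
qed

text \<open>
  For \<open>\<omega> = 0\<close> this is \<open>1 / z\<^sup>2\<close>, because division by zero gives \<open>0\<close>. Thus the principal part of the
  Weierstrass function at the origin is the term of index \<open>0\<close> of a sum over the whole lattice.
\<close>
definition wp_term :: "complex \<Rightarrow> complex \<Rightarrow> complex" where
  "wp_term z \<omega> = 1 / (z - \<omega>)\<^sup>2 - 1 / \<omega>\<^sup>2"

lemma wp_term_bound:
  assumes "norm z \<le> R" "norm \<omega> > 2 * R"
  shows "norm (wp_term z \<omega>) \<le> 10 * R / norm \<omega> ^ 3"
proof -
  have R: "R \<ge> 0" using assms(1) norm_ge_zero order_trans by blast
  define x where "x = norm \<omega>"
  have x: "x > 0" unfolding x_def using assms(2) R by linarith
  then have w0: "\<omega> \<noteq> 0" unfolding x_def by simp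
  have dist: "norm (z - \<omega>) \<ge> x / 2"
    using norm_triangle_ineq2[of \<omega> z] assms unfolding x_def norm_minus_commute[of z] by linarith
  then have nz: "z - \<omega> \<noteq> 0" using x by auto
  have "wp_term z \<omega> = z * (2 * \<omega> - z) / ((z - \<omega>)\<^sup>2 * \<omega>\<^sup>2)"
    using w0 nz by (simp add: wp_term_def field_simps) (simp add: power2_eq_square algebra_simps)
  then have "norm (wp_term z \<omega>) = norm z * norm (2 * \<omega> - z) / ((norm (z - \<omega>))\<^sup>2 * x\<^sup>2)"
    by (simp add: norm_mult norm_divide norm_power x_def)
  also have "\<dots> \<le> R * (5/2 * x) / ((x / 2)\<^sup>2 * x\<^sup>2)"
  proof (intro frac_le mult_mono power_mono)
    have "norm (2 * \<omega> - z) \<le> 2 * x + norm z"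
      using norm_triangle_ineq4[of "2 * \<omega>" z] by (simp add: norm_mult x_def)
    then show "norm (2 * \<omega> - z) \<le> 5/2 * x" using assms x_def by linarith
  qed (use assms x R dist in auto)
  also have "\<dots> = 10 * R / x ^ 3" using x by (simp add: power2_eq_square power3_eq_cube)
  finally show ?thesis by (simp add: x_def)
qed

lemma wp_term_majorant:
  assumes "A \<subseteq> \<Lambda>"
  shows "(\<lambda>\<omega>. 10 * R / norm \<omega> ^ 3) summable_on A"
proof -
  have "(\<lambda>\<omega>. 10 * R * (1 / norm \<omega> ^ 3)) summable_on \<Lambda>"
    by (intro summable_on_cmult_right summable_on_lattice_inverse_cube)
  then show ?thesis using summable_on_subset_banach[OF _ assms] by simp
qed

lemma wp_term_summable:
  assumes "A \<subseteq> \<Lambda>"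
  shows "wp_term z summable_on A"
proof -
  define K where "K = {\<omega> \<in> A. norm \<omega> \<le> 2 * norm z}"
  have "finite K" by (rule finite_subset[OF _ finite_lattice_ball[of "2 * norm z"]]) (use assms K_def in auto)
  then have "wp_term z summable_on K" by (rule summable_on_finite)
  moreover have "wp_term z summable_on (A - K)"
  proof (rule abs_summable_summable, rule Infinite_Sum.abs_summable_on_comparison_test')
    show "(\<lambda>\<omega>. 10 * norm z / norm \<omega> ^ 3) summable_on (A - K)"
      by (rule wp_term_majorant) (use assms in auto)
  qed (use wp_term_bound in \<open>auto simp: K_def not_le\<close>)
  ultimately have "wp_term z summable_on (K \<union> (A - K))" by (rule summable_on_union)
  then show ?thesis by (simp add: K_def Un_absorb1)
qed

text \<open>
  On a disc of radius \<open>R\<close> the finitely many terms with \<open>|\<omega>| \<le> 2 R\<close> are split off; the rest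
  converges uniformly by the Weierstrass test. The index set \<open>A\<close> is arbitrary so that the lemma
  covers both the Weierstrass function and its regular part at the origin.
\<close>
lemma wp_partial_sum_holomorphic:
  assumes "A \<subseteq> \<Lambda>"
  shows "(\<lambda>z. \<Sum>\<^sub>\<infinity>\<omega>\<in>A. wp_term z \<omega>) holomorphic_on - A"
proof -
  have "\<exists>U. open U \<and> z \<in> U \<and> (\<lambda>z. \<Sum>\<^sub>\<infinity>\<omega>\<in>A. wp_term z \<omega>) holomorphic_on U" if z: "z \<in> - A" for z
  proof -
    define R where "R = norm z + 1"
    have R: "R > 0" unfolding R_def by (simp add: add_nonneg_pos)
    define K where "K = {\<omega> \<in> A. norm \<omega> \<le> 2 * R}"
    have fin: "finite K" by (rule finite_subset[OF _ finite_lattice_ball[of "2 * R"]]) (use assms K_def in auto)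
    have split: "(\<Sum>\<^sub>\<infinity>\<omega>\<in>A. wp_term w \<omega>) = (\<Sum>\<omega>\<in>K. wp_term w \<omega>) + (\<Sum>\<^sub>\<infinity>\<omega>\<in>A - K. wp_term w \<omega>)" for w
    proof -
      have "(\<Sum>\<^sub>\<infinity>\<omega>\<in>K \<union> (A - K). wp_term w \<omega>) = (\<Sum>\<^sub>\<infinity>\<omega>\<in>K. wp_term w \<omega>) + (\<Sum>\<^sub>\<infinity>\<omega>\<in>A - K. wp_term w \<omega>)"
        by (rule infsum_Un_disjoint) (use assms K_def in \<open>auto intro!: wp_term_summable\<close>)
      moreover have "K \<union> (A - K) = A" by (auto simp: K_def)
      ultimately show ?thesis using fin by simp
    qed
    have ul: "uniform_limit (cball 0 R) (\<lambda>X w. \<Sum>\<omega>\<in>X. wp_term w \<omega>) (\<lambda>w. \<Sum>\<^sub>\<infinity>\<omega>\<in>A - K. wp_term w \<omega>)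
        (finite_subsets_at_top (A - K))"
      by (rule Weierstrass_m_test_general[where M = "\<lambda>\<omega>. 10 * R / norm \<omega> ^ 3"])
         (use assms in \<open>auto simp: K_def not_le intro!: wp_term_bound wp_term_majorant\<close>)
    have nz: "w - \<omega> \<noteq> 0" if "w \<in> cball 0 R" "\<omega> \<in> A - K" for w \<omega>
      using that R by (auto simp: K_def)
    have "eventually (\<lambda>X. continuous_on (cball 0 R) (\<lambda>w. \<Sum>\<omega>\<in>X. wp_term w \<omega>)
        \<and> (\<lambda>w. \<Sum>\<omega>\<in>X. wp_term w \<omega>) holomorphic_on ball 0 R) (finite_subsets_at_top (A - K))"
    proof (rule eventually_finite_subsets_at_top_weakI)
      fix X assume X: "finite X" "X \<subseteq> A - K"
      have "(\<lambda>w. \<Sum>\<omega>\<in>X. wp_term w \<omega>) holomorphic_on cball 0 R"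
        unfolding wp_term_def by (intro holomorphic_intros) (use nz X in auto)
      then show "continuous_on (cball 0 R) (\<lambda>w. \<Sum>\<omega>\<in>X. wp_term w \<omega>)
        \<and> (\<lambda>w. \<Sum>\<omega>\<in>X. wp_term w \<omega>) holomorphic_on ball 0 R"
        using holomorphic_on_imp_continuous_on holomorphic_on_subset[OF _ ball_subset_cball] by blast
    qed
    from holomorphic_uniform_limit[OF this ul] 
    have tail: "(\<lambda>w. \<Sum>\<^sub>\<infinity>\<omega>\<in>A - K. wp_term w \<omega>) holomorphic_on ball 0 R" by auto
    define U where "U = ball 0 R - K"
    have "open U" unfolding U_def using fin by (intro open_Diff finite_imp_closed) auto
    moreover have "z \<in> U" using z by (auto simp: U_def R_def K_def)
    moreover have "(\<lambda>w. (\<Sum>\<omega>\<in>K. wp_term w \<omega>) + (\<Sum>\<^sub>\<infinity>\<omega>\<in>A - K. wp_term w \<omega>)) holomorphic_on U"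
    proof (intro holomorphic_on_add)
      show "(\<lambda>w. \<Sum>\<^sub>\<infinity>\<omega>\<in>A - K. wp_term w \<omega>) holomorphic_on U"
        using tail by (rule holomorphic_on_subset) (auto simp: U_def)
      show "(\<lambda>w. \<Sum>\<omega>\<in>K. wp_term w \<omega>) holomorphic_on U"
        unfolding wp_term_def by (intro holomorphic_intros) (auto simp: U_def)
    qed
    ultimately show ?thesis unfolding split[abs_def] by blast
  qed
  then show ?thesis
    unfolding holomorphic_on_def[of _ "- A"]
    using holomorphic_on_imp_differentiable_at field_differentiable_at_within by blast
qed

abbreviation wp :: "complex \<Rightarrow> complex" where "wp \<equiv> weierstrass_p \<omega>1 \<omega>2"

lemma wp_split: "wp z = 1 / z\<^sup>2 + (\<Sum>\<^sub>\<infinity>\<omega>\<in>\<Lambda> - {0}. wp_term z \<omega>)"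
  by (simp add: weierstrass_p_def wp_term_def)

lemma wp_eq_infsum: "wp z = (\<Sum>\<^sub>\<infinity>\<omega>\<in>\<Lambda>. wp_term z \<omega>)"
proof -
  have "(\<Sum>\<^sub>\<infinity>\<omega>\<in>{0} \<union> (\<Lambda> - {0}). wp_term z \<omega>)
      = (\<Sum>\<^sub>\<infinity>\<omega>\<in>{0}. wp_term z \<omega>) + (\<Sum>\<^sub>\<infinity>\<omega>\<in>\<Lambda> - {0}. wp_term z \<omega>)"
    by (rule infsum_Un_disjoint) (auto intro!: wp_term_summable)
  moreover have "{0} \<union> (\<Lambda> - {0}) = \<Lambda>" by auto
  ultimately show ?thesis by (simp add: wp_split wp_term_def)
qed

lemma wp_holomorphic: "wp holomorphic_on - \<Lambda>"
  using wp_partial_sum_holomorphic[of \<Lambda>] by (simp add: wp_eq_infsum[abs_def])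

lemma wp_even: "wp (- z) = wp z"
proof -
  have "bij_betw uminus \<Lambda> \<Lambda>"
    by (rule bij_betwI[of _ _ _ uminus]) (auto intro: lattice_minus)
  then have "(\<Sum>\<^sub>\<infinity>\<omega>\<in>\<Lambda>. wp_term (- z) (- \<omega>)) = wp (- z)"
    using infsum_reindex_bij_betw[of uminus \<Lambda> \<Lambda> "wp_term (- z)"] by (simp add: wp_eq_infsum)
  moreover have "wp_term (- z) (- \<omega>) = wp_term z \<omega>" for \<omega>
    by (simp add: wp_term_def power2_commute)
  ultimately show ?thesis by (simp add: wp_eq_infsum)
qed

text \<open>
  Reindexing the sum shows that the difference is the sum of \<open>1 / \<omega>\<^sup>2 - 1 / (\<omega> + \<omega>0)\<^sup>2\<close> over the
  lattice, and the reflection of the index \<open>\<omega>\<close> to \<open>- \<omega> - \<omega>0\<close> changes the sign of this sum.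
\<close>
lemma wp_periodic:
  assumes "\<omega>0 \<in> \<Lambda>"
  shows "wp (z + \<omega>0) = wp z"
proof -
  define c where "c = (\<Sum>\<^sub>\<infinity>\<omega>\<in>\<Lambda>. 1 / \<omega>\<^sup>2 - 1 / (\<omega> + \<omega>0)\<^sup>2)"
  have b1: "bij_betw (\<lambda>\<omega>. \<omega> + \<omega>0) \<Lambda> \<Lambda>"
    by (rule bij_betwI[of _ _ _ "\<lambda>\<omega>. \<omega> - \<omega>0"]) (use assms in \<open>auto intro: lattice_add lattice_diff\<close>)
  have b2: "bij_betw (\<lambda>\<omega>. - \<omega> - \<omega>0) \<Lambda> \<Lambda>"
    by (rule bij_betwI[of _ _ _ "\<lambda>\<omega>. - \<omega> - \<omega>0"]) (use assms in \<open>auto intro: lattice_minus lattice_diff\<close>)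
  have eq: "wp_term (z + \<omega>0) (\<omega> + \<omega>0) - wp_term z \<omega> = 1 / \<omega>\<^sup>2 - 1 / (\<omega> + \<omega>0)\<^sup>2" for \<omega>
    by (simp add: wp_term_def)
  have s: "(\<lambda>\<omega>. wp_term (z + \<omega>0) (\<omega> + \<omega>0)) summable_on \<Lambda>"
    using summable_on_reindex_bij_betw[OF b1, of "wp_term (z + \<omega>0)"] wp_term_summable[of \<Lambda>] by simp
  have "wp (z + \<omega>0) = (\<Sum>\<^sub>\<infinity>\<omega>\<in>\<Lambda>. wp_term (z + \<omega>0) (\<omega> + \<omega>0))"
    using infsum_reindex_bij_betw[OF b1, of "wp_term (z + \<omega>0)"] by (simp add: wp_eq_infsum)
  then have "wp (z + \<omega>0) - wp z = (\<Sum>\<^sub>\<infinity>\<omega>\<in>\<Lambda>. wp_term (z + \<omega>0) (\<omega> + \<omega>0) - wp_term z \<omega>)"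
  proof -
    have n: "(\<lambda>\<omega>. - wp_term z \<omega>) summable_on \<Lambda>"
      using wp_term_summable[of \<Lambda> z] by (simp only: summable_on_uminus)
    have "(\<Sum>\<^sub>\<infinity>\<omega>\<in>\<Lambda>. - wp_term z \<omega>) = - wp z"
      unfolding wp_eq_infsum by (rule infsum_uminus)
    then show ?thesis using infsum_add[OF s n] \<open>wp (z + \<omega>0) = _\<close> by simp
  qed
  then have diff: "wp (z + \<omega>0) - wp z = c" by (simp add: eq c_def)
  have "c = (\<Sum>\<^sub>\<infinity>\<omega>\<in>\<Lambda>. 1 / (- \<omega> - \<omega>0)\<^sup>2 - 1 / (- \<omega> - \<omega>0 + \<omega>0)\<^sup>2)"
    unfolding c_def using infsum_reindex_bij_betw[OF b2, of "\<lambda>\<omega>. 1 / \<omega>\<^sup>2 - 1 / (\<omega> + \<omega>0)\<^sup>2"] by simp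
  also have "\<dots> = (\<Sum>\<^sub>\<infinity>\<omega>\<in>\<Lambda>. - (1 / \<omega>\<^sup>2 - 1 / (\<omega> + \<omega>0)\<^sup>2))"
  proof (rule infsum_cong)
    fix \<omega> have "(- \<omega> - \<omega>0)\<^sup>2 = (\<omega> + \<omega>0)\<^sup>2" by (simp add: power2_eq_square algebra_simps)
    then show "1 / (- \<omega> - \<omega>0)\<^sup>2 - 1 / (- \<omega> - \<omega>0 + \<omega>0)\<^sup>2 = - (1 / \<omega>\<^sup>2 - 1 / (\<omega> + \<omega>0)\<^sup>2)" by simp
  qed
  also have "\<dots> = - c" unfolding c_def by (rule infsum_uminus)
  finally have "c = 0" by simp
  then show ?thesis using diff by simp
qed

lemma wp_regular_part: "(\<lambda>z. wp z - 1 / z\<^sup>2) \<midarrow>0\<rightarrow> 0"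
proof -
  define r where "r = (\<lambda>z. \<Sum>\<^sub>\<infinity>\<omega>\<in>\<Lambda> - {0}. wp_term z \<omega>)"
  have "r holomorphic_on - (\<Lambda> - {0})" unfolding r_def by (rule wp_partial_sum_holomorphic) auto
  moreover have "open (- (\<Lambda> - {0}))" using closed_lattice_subset by (intro open_Compl) auto
  ultimately have "isCont r 0"
    using holomorphic_on_imp_continuous_on continuous_on_eq_continuous_at by blast
  moreover have "r 0 = 0" by (simp add: r_def wp_term_def)
  ultimately have "r \<midarrow>0\<rightarrow> 0" by (simp add: isCont_def)
  then show ?thesis by (simp add: wp_split r_def)
qed

lemma wp_square_limit: "(\<lambda>z. wp z * z\<^sup>2) \<midarrow>0\<rightarrow> 1"
proof -
  have "(\<lambda>z. (wp z - 1 / z\<^sup>2) * z\<^sup>2 + 1) \<midarrow>0\<rightarrow> 0 * 0\<^sup>2 + 1"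
    by (intro tendsto_intros wp_regular_part)
  then have "(\<lambda>z. (wp z - 1 / z\<^sup>2) * z\<^sup>2 + 1) \<midarrow>0\<rightarrow> 1" by simp
  then show ?thesis
    by (rule Lim_transform_eventually) (simp add: eventually_at_filter left_diff_distrib)
qed

text \<open>
  Liouville's theorem for elliptic functions. The exceptional set may be any part of the half
  lattice, which is discrete, so the existence of the limits makes all singularities removable.
\<close>
lemma elliptic_removable_imp_constant:
  assumes S: "\<And>z. z \<in> S \<Longrightarrow> 2 * z \<in> \<Lambda>"
    and hol: "f holomorphic_on - S"
    and per: "\<And>z \<omega>. \<omega> \<in> \<Lambda> \<Longrightarrow> f (z + \<omega>) = f z"
    and lim: "\<And>z. z \<in> S \<Longrightarrow> \<exists>l. f \<midarrow>z\<rightarrow> l"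
  obtains c where "\<And>z. z \<notin> S \<Longrightarrow> f z = c" "\<And>z. f \<midarrow>z\<rightarrow> c"
proof -
  have op: "open (- S)" using closed_half_lattice_subset[OF S] by auto
  have an: "f analytic_on {z}" if "z \<notin> S" for z
    using hol op that analytic_on_open analytic_on_subset[of f "- S" "{z}"] by blast
  have iso: "isolated_singularity_at f z" for z
  proof -
    define S' where "S' = S - {z}"
    have "closed S'" by (rule closed_half_lattice_subset) (use S in \<open>auto simp: S'_def\<close>)
    then have "open (- S')" by auto
    moreover have "z \<in> - S'" by (simp add: S'_def)
    ultimately obtain r where r: "r > 0" "ball z r \<subseteq> - S'" using open_contains_ball by blast
    have "f holomorphic_on (ball z r - {z})"
      by (rule holomorphic_on_subset[OF hol]) (use r in \<open>auto simp: S'_def\<close>)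
    then have "f analytic_on (ball z r - {z})" by (subst analytic_on_open) auto
    then show ?thesis unfolding isolated_singularity_at_def using r by blast
  qed
  have limex: "\<exists>l. f \<midarrow>z\<rightarrow> l" for z
  proof (cases "z \<in> S")
    case False
    then show ?thesis using analytic_at_imp_isCont[OF an] by (auto simp: isCont_def)
  qed (use lim in auto)
  define g where "g = remove_sings f"
  have "g analytic_on {z}" for z
    using limex[of z] remove_sings_analytic_at[OF iso] unfolding g_def by blast
  then have "g analytic_on UNIV" using analytic_on_analytic_at by blast
  then have g: "g holomorphic_on UNIV" by (simp add: analytic_imp_holomorphic)
  have gper: "g (z + \<omega>) = g z" if "\<omega> \<in> \<Lambda>" for z \<omega>
  proof -
    obtain l where l: "f \<midarrow>z + \<omega>\<rightarrow> l" using limex by blast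
    then have "(\<lambda>h. f (z + \<omega> + h)) \<midarrow>0\<rightarrow> l" by (simp add: LIM_offset_zero)
    then have "(\<lambda>h. f (z + h)) \<midarrow>0\<rightarrow> l"
      using per[OF that, of "z + h" for h] by (simp add: add.commute add.left_commute)
    then have "f \<midarrow>z\<rightarrow> l" by (simp add: LIM_offset_zero_cancel)
    then show ?thesis using l remove_sings_eqI unfolding g_def by metis
  qed
  have "bounded (g ` closed_parallelogram)"
    by (intro compact_imp_bounded compact_continuous_image compact_closed_parallelogram)
       (use holomorphic_on_imp_continuous_on[OF g] continuous_on_subset in blast)
  moreover have "range g \<subseteq> g ` closed_parallelogram"
  proof
    fix w assume "w \<in> range g"
    then obtain z where "w = g z" by blast
    moreover obtain \<omega> where "\<omega> \<in> \<Lambda>" "z + \<omega> \<in> P" by (rule reduce_to_parallelogram)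
    ultimately show "w \<in> g ` closed_parallelogram"
      using gper parallelogram_subset by (metis image_eqI subsetD)
  qed
  ultimately have "bounded (range g)" using bounded_subset by blast
  then obtain c where c: "\<And>z. g z = c" using Liouville_theorem[OF g] by (metis constant_on_def UNIV_I)
  show ?thesis
  proof (rule that)
    show "f z = c" if "z \<notin> S" for z using remove_sings_at_analytic[OF an[OF that]] c by (simp add: g_def)
    show "f \<midarrow>z\<rightarrow> c" for z using limex[of z] c remove_sings_eqI unfolding g_def by metis
  qed
qed

section \<open>Values at the half periods\<close>

definition half_period :: "complex \<Rightarrow> bool" where
  "half_period c \<longleftrightarrow> c \<notin> \<Lambda> \<and> 2 * c \<in> \<Lambda>"

lemma lattice_add_iff: "\<omega> \<in> \<Lambda> \<Longrightarrow> z + \<omega> \<in> \<Lambda> \<longleftrightarrow> z \<in> \<Lambda>"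
  using lattice_add[of z \<omega>] lattice_diff[of "z + \<omega>" \<omega>] by auto

lemma wp_cong: "z - w \<in> \<Lambda> \<Longrightarrow> wp z = wp w"
  using wp_periodic[of "z - w" w] by simp

lemma wp_cong_minus: "z + w \<in> \<Lambda> \<Longrightarrow> wp z = wp w"
  using wp_cong[of z "- w"] by (simp add: wp_even)

lemma isCont_wp: "z \<notin> \<Lambda> \<Longrightarrow> isCont wp z"
  using holomorphic_on_imp_continuous_on[OF wp_holomorphic] closed_lattice_subset[of \<Lambda>]
  by (simp add: continuous_on_eq_continuous_at open_Compl)

lemma wp_shift_holomorphic: "(\<lambda>z. wp (z + c)) holomorphic_on {z. z + c \<notin> \<Lambda>}"
proof -
  have "(wp \<circ> (\<lambda>z. z + c)) holomorphic_on {z. z + c \<notin> \<Lambda>}"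
    by (rule holomorphic_on_compose_gen[OF _ wp_holomorphic]) (auto intro!: holomorphic_intros)
  then show ?thesis by (simp add: o_def)
qed

lemma open_off_lattice: "open {z. z + c \<notin> \<Lambda>}"
proof -
  have "open ((\<lambda>z. z + c) -` (- \<Lambda>))"
    by (intro open_vimage open_Compl closed_lattice_subset continuous_intros order_refl)
  then show ?thesis by (simp add: vimage_def)
qed

lemma wp_half_period_shift_even: "half_period c \<Longrightarrow> wp (- z + c) = wp (z + c)"
  by (rule wp_cong_minus) (simp add: half_period_def)

text \<open>
  The product has removable singularities: near \<open>0\<close> the double pole of the first factor is
  compensated by the double zero of the second factor, which is even around the half period \<open>c\<close>. All
  other singularities are translates of this one, because the product is invariant under \<open>z \<mapsto> z + c\<close>.
  The constant is nonzero, since otherwise \<open>\<wp> - \<wp>(c)\<close> would vanish near \<open>c\<close> and then everywhere, in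
  spite of its pole.
\<close>
lemma wp_half_period_product:
  assumes c: "half_period c"
  obtains \<kappa> where "\<kappa> \<noteq> 0"
    "\<And>z. z \<notin> \<Lambda> \<Longrightarrow> z + c \<notin> \<Lambda> \<Longrightarrow> (wp z - wp c) * (wp (z + c) - wp c) = \<kappa>"
proof -
  define f where "f = (\<lambda>z. wp z - wp c)"
  define E where "E = (\<lambda>z. f z * f (z + c))"
  define S where "S = {z. z \<in> \<Lambda> \<or> z + c \<in> \<Lambda>}"
  have c2: "2 * c \<in> \<Lambda>" "c \<notin> \<Lambda>" using c by (auto simp: half_period_def)
  have fper: "f (z + \<omega>) = f z" if "\<omega> \<in> \<Lambda>" for z \<omega> using wp_periodic[OF that] by (simp add: f_def)
  have Eper: "E (z + \<omega>) = E z" if "\<omega> \<in> \<Lambda>" for z \<omega>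
    using fper[OF that, of z] fper[OF that, of "z + c"] by (simp add: E_def add.assoc add.commute[of \<omega> c])
  have Ec: "E (z + c) = E z" for z
    using fper[OF c2(1), of z] by (simp add: E_def add.assoc mult.commute)
  have Eshift: "E (d + h) = E h" if "d \<in> S" for d h
  proof (cases "d \<in> \<Lambda>")
    case True
    then show ?thesis using Eper[of d h] by (simp add: add.commute)
  next
    case False
    then have "d + c \<in> \<Lambda>" using that by (auto simp: S_def)
    then have "E (h + (d + c)) = E h" by (rule Eper)
    then show ?thesis using Ec[of "d + h"] by (simp add: algebra_simps)
  qed
  have pole: "(\<lambda>z. f z * z\<^sup>2) \<midarrow>0\<rightarrow> 1"
  proof -
    have "(\<lambda>z. wp z * z\<^sup>2 - wp c * z\<^sup>2) \<midarrow>0\<rightarrow> 1 - wp c * 0\<^sup>2"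
      by (intro tendsto_intros wp_square_limit)
    then show ?thesis by (simp add: f_def left_diff_distrib)
  qed
  have nz: "eventually (\<lambda>z. f z \<noteq> 0) (at 0)"
  proof -
    have "eventually (\<lambda>z. f z * z\<^sup>2 \<noteq> 0) (at 0)"
      by (rule tendsto_imp_eventually_ne[OF pole]) simp
    then show ?thesis by eventually_elim auto
  qed
  have "\<exists>l. (\<lambda>z. f (z + c) / z\<^sup>2) \<midarrow>0\<rightarrow> l"
  proof (rule even_zero_quotient_limit)
    show "open {z. z + c \<notin> \<Lambda>}" by (rule open_off_lattice)
    show "0 \<in> {z. z + c \<notin> \<Lambda>}" using c2 by simp
    show "(\<lambda>z. f (z + c)) holomorphic_on {z. z + c \<notin> \<Lambda>}"
      unfolding f_def by (intro holomorphic_intros wp_shift_holomorphic)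
    show "f (0 + c) = 0" by (simp add: f_def)
    show "f (- z + c) = f (z + c)" for z using wp_half_period_shift_even[OF c, of z] by (simp only: f_def)
  qed
  then obtain l where l: "(\<lambda>z. f (z + c) / z\<^sup>2) \<midarrow>0\<rightarrow> l" ..
  have E0: "E \<midarrow>0\<rightarrow> l"
  proof -
    have "(\<lambda>z. (f z * z\<^sup>2) * (f (z + c) / z\<^sup>2)) \<midarrow>0\<rightarrow> 1 * l"
      by (intro tendsto_mult pole l)
    then have "(\<lambda>z. (f z * z\<^sup>2) * (f (z + c) / z\<^sup>2)) \<midarrow>0\<rightarrow> l" by simp
    then show ?thesis by (rule Lim_transform_eventually) (simp add: eventually_at_filter E_def)
  qed
  have S2: "2 * z \<in> \<Lambda>" if "z \<in> S" for z
  proof (cases "z \<in> \<Lambda>")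
    case False
    then have "2 * (z + c) - 2 * c \<in> \<Lambda>" using that False c2(1) by (intro lattice_diff[OF lattice_double]) (simp_all add: S_def)
    then show ?thesis by (simp add: algebra_simps)
  qed (rule lattice_double)
  have Ehol: "E holomorphic_on - S"
  proof -
    have "wp holomorphic_on - S" by (rule holomorphic_on_subset[OF wp_holomorphic]) (auto simp: S_def)
    moreover have "(\<lambda>z. wp (z + c)) holomorphic_on - S"
      by (rule holomorphic_on_subset[OF wp_shift_holomorphic]) (auto simp: S_def)
    ultimately show ?thesis unfolding E_def f_def by (intro holomorphic_intros)
  qed
  have Elim: "\<exists>l. E \<midarrow>z\<rightarrow> l" if "z \<in> S" for z
  proof
    have "(\<lambda>h. E (z + h)) \<midarrow>0\<rightarrow> l" using E0 Eshift[OF that] by simp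
    then show "E \<midarrow>z\<rightarrow> l" by (rule LIM_offset_zero_cancel)
  qed
  obtain \<kappa> where \<kappa>: "\<And>z. z \<notin> S \<Longrightarrow> E z = \<kappa>" "\<And>z. E \<midarrow>z\<rightarrow> \<kappa>"
    by (rule elliptic_removable_imp_constant[OF S2 Ehol Eper Elim]) blast+
  have "\<kappa> \<noteq> 0"
  proof
    assume "\<kappa> = 0"
    \<comment> \<open>Near \<open>0\<close> the factor \<open>f z\<close> is large, hence nonzero, so the other factor \<open>f (z + c)\<close> vanishes.\<close>
    have "eventually (\<lambda>z. z \<in> {z. z + c \<notin> \<Lambda>}) (nhds 0)"
      using c2 by (intro eventually_nhds_in_open open_off_lattice) simp
    then have "eventually (\<lambda>z. z + c \<notin> \<Lambda>) (at 0)"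
      by (auto simp: eventually_at_filter elim: eventually_mono)
    moreover have "eventually (\<lambda>z. z \<in> - (\<Lambda> - {0})) (nhds 0)"
      by (intro eventually_nhds_in_open open_Compl closed_lattice_subset) auto
    then have "eventually (\<lambda>z. z \<notin> \<Lambda>) (at 0)"
      by (auto simp: eventually_at_filter elim: eventually_mono)
    ultimately have ev: "eventually (\<lambda>z. f (z + c) = 0 \<and> z + c \<notin> \<Lambda> \<and> z \<notin> \<Lambda> \<and> f z \<noteq> 0) (at 0)"
      using nz
    proof eventually_elim
      case (elim z)
      then have "E z = 0" using \<kappa>(1)[of z] \<open>\<kappa> = 0\<close> by (simp add: S_def)
      then show ?case using elim by (simp add: E_def)
    qed
    define U where "U = {z \<in> - \<Lambda>. f z = 0}"
    have "c islimpt U"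
    proof -
      have "eventually (\<lambda>z. z \<in> U) (at c)"
        unfolding eventually_at_to_0[of _ c] using ev by eventually_elim (simp add: U_def)
      then have "\<not> eventually (\<lambda>z. z \<notin> U) (at c)"
        using eventually_elim2[of "\<lambda>z. z \<in> U" "at c" "\<lambda>z. z \<notin> U" "\<lambda>_. False"] by auto
      then show ?thesis by (simp add: islimpt_iff_eventually)
    qed
    obtain z where z: "z \<notin> \<Lambda>" "f z \<noteq> 0"
      using eventually_happens[OF ev] by auto
    have "f z = 0"
    proof (rule analytic_continuation[of f "- \<Lambda>" U c])
      show "f holomorphic_on - \<Lambda>" unfolding f_def by (intro holomorphic_intros wp_holomorphic)
      show "open (- \<Lambda>)" by (intro open_Compl closed_lattice_subset order_refl)
      have "connected (UNIV - \<Lambda>)"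
        by (rule connected_open_diff_countable) (auto simp: countable_lattice)
      then show "connected (- \<Lambda>)" by (simp add: Compl_eq_Diff_UNIV)
    qed (use \<open>c islimpt U\<close> z c2 in \<open>auto simp: U_def\<close>)
    then show False using z by simp
  qed
  show ?thesis
  proof (rule that[OF \<open>\<kappa> \<noteq> 0\<close>])
    fix z assume "z \<notin> \<Lambda>" "z + c \<notin> \<Lambda>"
    then show "(wp z - wp c) * (wp (z + c) - wp c) = \<kappa>"
      using \<kappa>(1)[of z] by (simp add: S_def E_def f_def)
  qed
qed

lemma half_not_Int: "(1/2 :: real) \<notin> \<int>"
proof
  assume "(1/2 :: real) \<in> \<int>"
  then obtain k :: int where "1/2 = real_of_int k" by (auto elim: Ints_cases)
  then have "real_of_int (2 * k) = real_of_int 1" by simp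
  then have "2 * k = 1" by (simp only: of_int_eq_iff)
  then show False by presburger
qed

lemma half_period_generators:
  "half_period (\<omega>1 / 2)" "half_period (\<omega>2 / 2)" "half_period ((\<omega>1 + \<omega>2) / 2)"
  unfolding half_period_def lattice_iff by (simp_all add: half_not_Int)

text \<open>
  Here \<open>X\<close> and \<open>Y\<close> are the values of \<open>\<wp>\<close> at \<open>a/2\<close> and \<open>a/2 + b\<close>. By the second and third
  assumption \<open>X - e1\<close> and \<open>Y - e1\<close> agree up to sign. If they are equal, the fourth assumption gives
  \<open>X = e3\<close>, and then one of the two nonzero products vanishes. If they are opposite, the left-hand side
  of the first assumption is \<open>0\<close>.
\<close>
lemma sum_zero_from_half_shift_relations:
  fixes X Y e1 e2 e3 :: complex
  assumes "2 * X + 2 * Y - 4 * e1 = e1 + e2 + e3"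
    and "(X - e1)\<^sup>2 = (e2 - e1) * (e3 - e1)" "(Y - e1)\<^sup>2 = (e2 - e1) * (e3 - e1)"
    and "(X - e2) * (Y - e2) = (e1 - e2) * (e3 - e2)"
    and "(e2 - e1) * (e3 - e1) \<noteq> 0" "(e1 - e2) * (e3 - e2) \<noteq> 0"
  shows "e1 + e2 + e3 = 0"
proof -
  have "(X - e1)\<^sup>2 = (Y - e1)\<^sup>2" using assms by simp
  then consider "X - e1 = Y - e1" | "X - e1 = - (Y - e1)" by (auto simp: power2_eq_iff)
  then show ?thesis
  proof cases
    case 1
    then have "Y = X" by simp
    then have "(X - e2)\<^sup>2 = (e1 - e2) * (e3 - e2)" using assms(4) by (simp add: power2_eq_square)
    then have "2 * (e1 - e2) * (X - e3) = 0" using assms(2) by algebra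
    then have "X = e3" using assms(6) by auto
    with assms(2) have "(e3 - e1)\<^sup>2 = (e2 - e1) * (e3 - e1)" by (simp only:)
    then have "(e3 - e1) * (e3 - e2) = 0" by algebra
    then show ?thesis using assms(5,6) by auto
  next
    case 2
    then have "2 * X + 2 * Y - 4 * e1 = 0" by algebra
    then show ?thesis using assms(1) by simp
  qed
qed

text \<open>
  The sum of \<open>\<wp>\<close> over the four translates of \<open>z\<close> by the half periods and \<open>4 \<wp>(2 z)\<close> have the same
  principal parts, so they differ by a constant. For \<open>z \<rightarrow> 0\<close> this constant is seen to be the sum of
  the values at the half periods, because \<open>\<wp>(z) - 1 / z\<^sup>2\<close> tends to \<open>0\<close>. Evaluation at \<open>z = a/2\<close>, together with the
  constant products at half periods, forces it to be \<open>0\<close>.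
\<close>
lemma wp_half_periods_sum: "wp (\<omega>1 / 2) + wp (\<omega>2 / 2) + wp ((\<omega>1 + \<omega>2) / 2) = 0"
proof -
  define a where "a = \<omega>1 / 2"
  define b where "b = \<omega>2 / 2"
  have hp: "half_period a" "half_period b" "half_period (a + b)"
    using half_period_generators by (simp_all add: a_def b_def add_divide_distrib)
  have L: "2 * a \<in> \<Lambda>" "2 * b \<in> \<Lambda>" "a \<notin> \<Lambda>" "b \<notin> \<Lambda>" "a + b \<notin> \<Lambda>"
    using hp by (auto simp: half_period_def)
  define D where "D = (\<lambda>z. wp z + wp (z + a) + wp (z + b) + wp (z + (a + b)) - 4 * wp (2 * z))"
  define S where "S = {z. 2 * z \<in> \<Lambda>}"
  have Dper: "D (z + \<omega>) = D z" if \<omega>: "\<omega> \<in> \<Lambda>" for z \<omega>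
  proof -
    have "wp (z + \<omega> + d) = wp (z + d)" for d
      by (rule wp_cong) (use \<omega> in simp)
    moreover have "wp (2 * (z + \<omega>)) = wp (2 * z)"
      by (rule wp_cong) (use lattice_double[OF \<omega>] in \<open>simp add: algebra_simps\<close>)
    ultimately show ?thesis using wp_periodic[OF \<omega>] by (simp add: D_def)
  qed
  have Da: "D (z + a) = D z" for z
  proof -
    have "wp (z + a + a) = wp z" by (rule wp_cong) (use L in simp)
    moreover have "wp (z + a + (a + b)) = wp (z + b)" by (rule wp_cong) (use L in simp)
    moreover have "wp (2 * (z + a)) = wp (2 * z)" by (rule wp_cong) (use L in \<open>simp add: algebra_simps\<close>)
    moreover have "z + a + b = z + (a + b)" by simp
    ultimately show ?thesis unfolding D_def by (simp only: ac_simps)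
  qed
  have Db: "D (z + b) = D z" for z
  proof -
    have "wp (z + b + b) = wp z" by (rule wp_cong) (use L in simp)
    moreover have "wp (z + b + (a + b)) = wp (z + a)" by (rule wp_cong) (use L in \<open>simp add: algebra_simps\<close>)
    moreover have "wp (2 * (z + b)) = wp (2 * z)" by (rule wp_cong) (use L in \<open>simp add: algebra_simps\<close>)
    moreover have "z + b + a = z + (a + b)" by simp
    ultimately show ?thesis unfolding D_def by (simp only: ac_simps)
  qed
  have Dmult: "D (z + of_int m * d) = D z" if d: "\<And>z. D (z + d) = D z" "2 * d \<in> \<Lambda>" for z m d
  proof -
    have even: "D (z + of_int (2 * q) * d) = D z" for z q
    proof (rule Dper)
      have "of_int (2 * q) * d = of_int q * (2 * d)" by simp
      also have "\<dots> \<in> \<Lambda>" using d(2) unfolding lattice_iff by (simp del: coord_double)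
      finally show "of_int (2 * q) * d \<in> \<Lambda>" .
    qed
    show ?thesis
    proof (cases "even m")
      case True
      then show ?thesis using even by (auto elim!: evenE)
    next
      case False
      then obtain q where "m = 2 * q + 1" by (rule oddE)
      then have "z + of_int m * d = (z + of_int (2 * q) * d) + d" by (simp add: algebra_simps)
      then show ?thesis using d(1)[of "z + of_int (2 * q) * d"] even[of z q] by (simp only:)
    qed
  qed
  have DS: "D (d + h) = D h" if "d \<in> S" for d h
  proof -
    obtain m n where "2 * d = of_int m * \<omega>1 + of_int n * \<omega>2"
      using \<open>d \<in> S\<close> by (auto simp: S_def period_lattice_def)
    then have "d = of_int m * a + of_int n * b" by (simp add: a_def b_def field_simps)
    then have "d + h = (h + of_int m * a) + of_int n * b" by simp
    then show ?thesis
      using Dmult[OF Da L(1), of h m] Dmult[OF Db L(2), of "h + of_int m * a" n] by (simp only:)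
  qed
  have D0: "D \<midarrow>0\<rightarrow> wp a + wp b + wp (a + b)"
  proof -
    define r where "r = (\<lambda>z. wp z - 1 / z\<^sup>2)"
    have r: "r \<midarrow>0\<rightarrow> 0" unfolding r_def by (rule wp_regular_part)
    have r2: "(\<lambda>z. r (2 * z)) \<midarrow>0\<rightarrow> 0"
      by (rule filterlim_compose[OF r]) (auto simp: filterlim_at eventually_at_filter intro!: tendsto_eq_intros)
    have sh: "(\<lambda>z. wp (z + d)) \<midarrow>0\<rightarrow> wp d" if "d \<notin> \<Lambda>" for d
      using isCont_wp[OF that] LIM_offset_zero[of wp "wp d" d] by (simp add: isCont_def add.commute)
    have "(\<lambda>z. r z + wp (z + a) + wp (z + b) + wp (z + (a + b)) - 4 * r (2 * z)) \<midarrow>0\<rightarrow>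
        0 + wp a + wp b + wp (a + b) - 4 * 0"
      by (intro tendsto_intros r r2 sh L)
    then have "(\<lambda>z. r z + wp (z + a) + wp (z + b) + wp (z + (a + b)) - 4 * r (2 * z)) \<midarrow>0\<rightarrow>
        wp a + wp b + wp (a + b)" by simp
    moreover have "r z + wp (z + a) + wp (z + b) + wp (z + (a + b)) - 4 * r (2 * z) = D z" for z
      by (simp add: r_def D_def power_mult_distrib)
    ultimately show ?thesis by simp
  qed
  have Dhol: "D holomorphic_on - S"
  proof -
    have off: "z + d \<notin> \<Lambda>" if "z \<in> - S" "2 * d \<in> \<Lambda>" for z d
    proof
      assume "z + d \<in> \<Lambda>"
      then have "2 * (z + d) - 2 * d \<in> \<Lambda>" using that(2) by (rule lattice_diff[OF lattice_double])
      then show False using that by (simp add: S_def algebra_simps)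
    qed
    have sh: "(\<lambda>z. wp (z + d)) holomorphic_on - S" if "2 * d \<in> \<Lambda>" for d
      by (rule holomorphic_on_subset[OF wp_shift_holomorphic]) (use off[OF _ that] in auto)
    have "(wp \<circ> (\<lambda>z. 2 * z)) holomorphic_on - S"
      by (rule holomorphic_on_compose_gen[OF _ wp_holomorphic])
         (auto intro!: holomorphic_intros simp: S_def)
    then have dbl: "(\<lambda>z. wp (2 * z)) holomorphic_on - S" by (simp add: o_def)
    have "2 * (a + b) \<in> \<Lambda>" using lattice_add[OF L(1,2)] by (simp add: distrib_left)
    moreover have "wp holomorphic_on - S" using sh[of 0] by simp
    ultimately show ?thesis unfolding D_def
      by (intro holomorphic_on_add holomorphic_on_diff holomorphic_on_mult holomorphic_on_const sh dbl L)
  qed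
  have Dlim: "\<exists>l. D \<midarrow>z\<rightarrow> l" if "z \<in> S" for z
  proof
    have "(\<lambda>h. D (z + h)) \<midarrow>0\<rightarrow> wp a + wp b + wp (a + b)" using D0 DS[OF that] by simp
    then show "D \<midarrow>z\<rightarrow> wp a + wp b + wp (a + b)" by (rule LIM_offset_zero_cancel)
  qed
  have S2: "2 * z \<in> \<Lambda>" if "z \<in> S" for z using that by (simp add: S_def)
  obtain C where C: "\<And>z. z \<notin> S \<Longrightarrow> D z = C" "\<And>z. D \<midarrow>z\<rightarrow> C"
    by (rule elliptic_removable_imp_constant[OF S2 Dhol Dper Dlim]) blast+
  have C_eq: "C = wp a + wp b + wp (a + b)" using LIM_unique[OF C(2) D0] .
  obtain \<kappa>a where \<kappa>a: "\<kappa>a \<noteq> 0" "\<And>z. z \<notin> \<Lambda> \<Longrightarrow> z + a \<notin> \<Lambda> \<Longrightarrow> (wp z - wp a) * (wp (z + a) - wp a) = \<kappa>a"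
    by (rule wp_half_period_product[OF hp(1)]) blast
  obtain \<kappa>b where \<kappa>b: "\<kappa>b \<noteq> 0" "\<And>z. z \<notin> \<Lambda> \<Longrightarrow> z + b \<notin> \<Lambda> \<Longrightarrow> (wp z - wp b) * (wp (z + b) - wp b) = \<kappa>b"
    by (rule wp_half_period_product[OF hp(2)]) blast
  define q where "q = a / 2"
  have q2: "2 * q = a" by (simp add: q_def)
  have off: "q + d \<notin> \<Lambda>" if "2 * d \<in> \<Lambda>" for d
  proof
    assume "q + d \<in> \<Lambda>"
    then have "2 * (q + d) - 2 * d \<in> \<Lambda>" using that by (rule lattice_diff[OF lattice_double])
    then show False using L(3) q2 by (simp add: algebra_simps)
  qed
  have ab2: "2 * (a + b) \<in> \<Lambda>" using lattice_add[OF L(1,2)] by (simp add: distrib_left)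
  have e1: "wp (q + a) = wp q"
    by (rule wp_cong_minus) (use L(1) q2 in \<open>simp add: algebra_simps\<close>)
  have e2: "wp (q + b + a) = wp (q + b)"
    by (rule wp_cong_minus) (use ab2 q2 in \<open>simp add: algebra_simps\<close>)
  have "q \<notin> S" using q2 L(3) by (simp add: S_def)
  then have "D q = wp a + wp b + wp (a + b)" using C(1) C_eq by simp
  then have "2 * wp q + 2 * wp (q + b) - 4 * wp a = wp a + wp b + wp (a + b)"
    using e1 e2 q2 by (simp add: D_def add.assoc add.commute[of b a])
  moreover have ka: "(wp b - wp a) * (wp (a + b) - wp a) = \<kappa>a"
    using \<kappa>a(2)[of b] L by (simp add: add.commute)
  moreover have "(wp q - wp a)\<^sup>2 = (wp b - wp a) * (wp (a + b) - wp a)"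
    using \<kappa>a(2)[of q] off[of 0] off[OF L(1)] e1 ka by (simp add: power2_eq_square)
  moreover have "(wp (q + b) - wp a)\<^sup>2 = (wp b - wp a) * (wp (a + b) - wp a)"
    using \<kappa>a(2)[of "q + b"] off[OF L(2)] off[OF ab2] e2 ka by (simp add: power2_eq_square add.assoc add.commute[of b a])
  moreover have kb: "(wp a - wp b) * (wp (a + b) - wp b) = \<kappa>b"
    using \<kappa>b(2)[of a] L by simp
  moreover have "(wp q - wp b) * (wp (q + b) - wp b) = (wp a - wp b) * (wp (a + b) - wp b)"
    using \<kappa>b(2)[of q] off[of 0] off[OF L(2)] kb by simp
  ultimately have "wp a + wp b + wp (a + b) = 0"
    using \<kappa>a(1) \<kappa>b(1) by (intro sum_zero_from_half_shift_relations[of "wp q" "wp (q + b)"]) simp_all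
  then show ?thesis by (simp add: a_def b_def add_divide_distrib)
qed

end

section \<open>Test functions from reciprocal pairs\<close>

text \<open>
  The situation of a function \<open>F\<close> with poles \<open>a + \<Lambda>\<close> and zeros \<open>b + \<Lambda>\<close> for which \<open>F(z) F(z + c) = 1\<close>.
  The reciprocal \<open>H(z) = F(z + c)\<close> is a function of its own because the value \<open>H = 0\<close> at the poles of \<open>F\<close>
  is meaningful, while the value of \<open>F\<close> there is not.
\<close>
locale reciprocal_pair = complex_lattice +
  fixes F H :: "complex \<Rightarrow> complex" and a b c :: complex
  assumes F_hol: "F holomorphic_on {z. z - a \<notin> \<Lambda>}"
    and H_hol: "H holomorphic_on {z. z - b \<notin> \<Lambda>}"
    and reciprocal: "\<And>z. z - a \<notin> \<Lambda> \<Longrightarrow> z - b \<notin> \<Lambda> \<Longrightarrow> F z * H z = 1"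
    and F_zero: "\<And>z. z - b \<in> \<Lambda> \<Longrightarrow> F z = 0"
    and H_zero: "\<And>z. z - a \<in> \<Lambda> \<Longrightarrow> H z = 0"
    and distinct: "a - b \<notin> \<Lambda>"
    and F_periodic: "lattice_periodic \<omega>1 \<omega>2 F"
    and H_periodic: "lattice_periodic \<omega>1 \<omega>2 H"
    and F_shift: "\<And>z. F (z + c) = H z"
    and pole_shift: "\<And>z. z + c - a \<in> \<Lambda> \<longleftrightarrow> z - b \<in> \<Lambda>"
begin

text \<open>
  The value \<open>0\<close> at the poles is the limit: \<open>(|F|\<^sup>2 + s) / (|F|\<^sup>2 + t)\<close> tends to \<open>1\<close> when \<open>F\<close> tends to
  infinity.
\<close>
definition \<phi> :: "real \<Rightarrow> real \<Rightarrow> complex \<Rightarrow> real" where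
  "\<phi> s t z = (if z - a \<in> \<Lambda> then 0 else log_reg s F z - log_reg t F z)"

text \<open>
  At the poles the density is expressed by the reciprocal function, which is the continuous
  extension (\<open>\<mu>_via_H\<close>).
\<close>
definition \<mu> :: "real \<Rightarrow> complex \<Rightarrow> real" where
  "\<mu> s z = (if z - a \<in> \<Lambda> then spherical_density (1 / s) H z else spherical_density s F z)"

lemma disjoint: "z - a \<in> \<Lambda> \<Longrightarrow> z - b \<notin> \<Lambda>"
  using lattice_diff[of "z - b" "z - a"] distinct by auto

lemma open_off: "open {z. z - d \<notin> \<Lambda>}"
  using open_off_lattice[of "- d"] by simp

lemma coset_shift: "\<omega> \<in> \<Lambda> \<Longrightarrow> z + \<omega> - d \<in> \<Lambda> \<longleftrightarrow> z - d \<in> \<Lambda>"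
  using lattice_add_iff[of \<omega> "z - d"] by (simp add: algebra_simps)

lemma log_reg_reciprocal:
  assumes "F z * H z = 1" "s > 0"
  shows "log_reg s F z = ln s / 2 - ln (norm (H z)) + log_reg (1 / s) H z"
proof -
  define y where "y = norm (H z)"
  have "norm (F z) * y = 1" using arg_cong[OF assms(1), of norm] by (simp add: norm_mult y_def)
  moreover from this have "y > 0" using norm_ge_zero[of "H z"] by (auto simp: y_def)
  ultimately have y: "y > 0" "norm (F z) = 1 / y" by (simp_all add: field_simps)
  have "(1 / y)\<^sup>2 + s = s * (y\<^sup>2 + 1 / s) / y\<^sup>2"
    using y assms(2) by (simp add: field_simps)
  moreover have "y\<^sup>2 + 1 / s > 0" using assms(2) y by (simp add: add_pos_pos)
  ultimately have "ln ((1 / y)\<^sup>2 + s) = ln s + ln (y\<^sup>2 + 1 / s) - 2 * ln y"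
    using y assms(2) by (simp add: ln_div ln_mult ln_realpow)
  then show ?thesis
    by (simp only: log_reg_def y(2) y_def[symmetric]) (simp add: add_divide_distrib diff_divide_distrib)
qed

text \<open>
  In terms of \<open>H = 1/F\<close> one has \<open>|F|\<^sup>2 + s = s (|H|\<^sup>2 + 1/s) / |H|\<^sup>2\<close>, and the denominators cancel in the
  difference of logarithms. The resulting formula remains valid at the poles of \<open>F\<close> and exhibits
  smoothness there.
\<close>
lemma \<phi>_via_H:
  assumes "z - b \<notin> \<Lambda>" "s > 0" "t > 0"
  shows "\<phi> s t z = log_reg (1 / s) H z - log_reg (1 / t) H z + (ln s - ln t) / 2"
proof (cases "z - a \<in> \<Lambda>")
  case True
  then show ?thesis using H_zero[OF True] assms by (simp add: \<phi>_def log_reg_def ln_div field_simps)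
next
  case False
  have FH: "F z * H z = 1" by (rule reciprocal[OF False assms(1)])
  show ?thesis using False log_reg_reciprocal[OF FH assms(2)] log_reg_reciprocal[OF FH assms(3)]
    by (simp add: \<phi>_def field_simps)
qed

text \<open>
  The spherical density is invariant under the inversion of the sphere, which exchanges the
  parameters \<open>s\<close> and \<open>1/s\<close>.
\<close>
lemma \<mu>_via_H:
  assumes "z - b \<notin> \<Lambda>" "s > 0"
  shows "\<mu> s z = spherical_density (1 / s) H z"
proof (cases "z - a \<in> \<Lambda>")
  case False
  define U where "U = {z. z - a \<notin> \<Lambda>} \<inter> {z. z - b \<notin> \<Lambda>}"
  have U: "open U" "z \<in> U" unfolding U_def using open_off False assms by auto
  have FH: "F x * H x = 1" if "x \<in> U" for x using reciprocal that by (simp add: U_def)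
  have Hnz: "H x \<noteq> 0" if "x \<in> U" for x using FH[OF that] by auto
  have "(F has_field_derivative - (inverse (H z) * deriv H z * inverse (H z))) (at z)"
  proof (rule has_field_derivative_transform_within_open[OF _ U])
    have "(H has_field_derivative deriv H z) (at z)"
      using holomorphic_derivI[OF H_hol open_off] assms(1) by simp
    then show "((\<lambda>x. inverse (H x)) has_field_derivative - (inverse (H z) * deriv H z * inverse (H z))) (at z)"
      using Hnz[OF U(2)] by (rule DERIV_inverse')
    show "inverse (H x) = F x" if "x \<in> U" for x
      using FH[OF that] inverse_unique[of "H x" "F x"] by (simp add: mult.commute)
  qed
  then have dF: "deriv F z = - (inverse (H z) * deriv H z * inverse (H z))" by (rule DERIV_imp_deriv)
  define y where "y = norm (H z)"
  have y: "y > 0" using Hnz[OF U(2)] by (simp add: y_def)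
  have nF: "norm (F z) = 1 / y"
    using arg_cong[OF FH[OF U(2)], of norm] y by (simp add: norm_mult y_def field_simps)
  have ndF: "norm (deriv F z) = norm (deriv H z) / y\<^sup>2"
    by (simp add: dF norm_mult norm_inverse y_def power2_eq_square divide_inverse)
  have p: "y\<^sup>2 + 1 / s > 0" using assms(2) y by (simp add: add_pos_pos)
  have "(1 / y)\<^sup>2 + s = s * (y\<^sup>2 + 1 / s) / y\<^sup>2"
    using y assms(2) by (simp add: field_simps)
  then have "\<mu> s z = 2 * s * (norm (deriv H z) / y\<^sup>2)\<^sup>2 / (s * (y\<^sup>2 + 1 / s) / y\<^sup>2)\<^sup>2"
    using False by (simp add: \<mu>_def spherical_density_def nF ndF)
  also have "\<dots> = 2 * (1 / s) * (norm (deriv H z))\<^sup>2 / (y\<^sup>2 + 1 / s)\<^sup>2"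
  proof -
    define q where "q = y\<^sup>2 + 1 / s"
    have "2 * s * (n / y\<^sup>2)\<^sup>2 / (s * q / y\<^sup>2)\<^sup>2 = 2 * (1 / s) * n\<^sup>2 / q\<^sup>2" for n
      using p y assms(2) unfolding q_def[symmetric] by (simp add: power_divide power_mult_distrib) (simp add: power2_eq_square)
    then show ?thesis by (simp only: q_def)
  qed
  finally show ?thesis by (simp add: spherical_density_def y_def)
qed (simp add: \<mu>_def)

lemma \<phi>_smooth:
  assumes "s > 0" "t > 0"
  shows "smooth_fun (\<phi> s t)"
  unfolding smooth_fun_iff_smooth_upto
proof (intro allI smooth_upto_local)
  fix n and z :: complex
  show "\<exists>V. z \<in> V \<and> smooth_upto n V (\<phi> s t)"
  proof (cases "z - a \<in> \<Lambda>")
    case True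
    define V where "V = {z. z - b \<notin> \<Lambda>}"
    have "smooth_upto n V (\<lambda>z. log_reg (1 / s) H z - log_reg (1 / t) H z + (ln s - ln t) / 2)"
      using H_hol assms unfolding V_def
      by (intro smooth_upto_affine_diff smooth_upto_log_reg open_off) simp_all
    then have "smooth_upto n V (\<phi> s t)"
      by (rule smooth_upto_cong[rotated 2]) (use open_off \<phi>_via_H assms in \<open>auto simp: V_def\<close>)
    then show ?thesis using disjoint[OF True] by (auto simp: V_def)
  next
    case False
    define V where "V = {z. z - a \<notin> \<Lambda>}"
    have "smooth_upto n V (\<lambda>z. log_reg s F z - log_reg t F z + 0)"
      using F_hol assms unfolding V_def
      by (intro smooth_upto_affine_diff smooth_upto_log_reg open_off) simp_all
    then have "smooth_upto n V (\<phi> s t)"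
      by (rule smooth_upto_cong[rotated 2]) (use open_off in \<open>auto simp: V_def \<phi>_def\<close>)
    then show ?thesis using False by (auto simp: V_def)
  qed
qed

lemma \<phi>_periodic: "lattice_periodic \<omega>1 \<omega>2 (\<phi> s t)"
  unfolding lattice_periodic_def
proof (intro allI ballI)
  fix z \<omega> assume \<omega>: "\<omega> \<in> \<Lambda>"
  show "\<phi> s t (z + \<omega>) = \<phi> s t z"
    using coset_shift[OF \<omega>] periodicD[OF F_periodic \<omega>] by (simp add: \<phi>_def log_reg_def)
qed

lemma deriv_periodic:
  assumes "h holomorphic_on {z. z - d \<notin> \<Lambda>}" "lattice_periodic \<omega>1 \<omega>2 h" "\<omega> \<in> \<Lambda>" "z - d \<notin> \<Lambda>"
  shows "deriv h (z + \<omega>) = deriv h z"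
proof -
  have "(h has_field_derivative deriv h (z + \<omega>)) (at (z + \<omega>))"
    using holomorphic_derivI[OF assms(1) open_off] coset_shift[OF assms(3)] assms(4) by simp
  then have "((\<lambda>x. h (x + \<omega>)) has_field_derivative deriv h (z + \<omega>)) (at z)"
    by (simp add: DERIV_shift)
  then have "(h has_field_derivative deriv h (z + \<omega>)) (at z)"
    using periodicD[OF assms(2,3)] by simp
  then show ?thesis by (metis DERIV_imp_deriv)
qed

lemma \<mu>_periodic: "lattice_periodic \<omega>1 \<omega>2 (\<mu> s)"
  unfolding lattice_periodic_def
proof (intro allI ballI)
  fix z \<omega> assume \<omega>: "\<omega> \<in> \<Lambda>"
  show "\<mu> s (z + \<omega>) = \<mu> s z"
    using coset_shift[OF \<omega>] periodicD[OF F_periodic \<omega>] periodicD[OF H_periodic \<omega>] disjoint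
      deriv_periodic[OF F_hol F_periodic \<omega>, of z] deriv_periodic[OF H_hol H_periodic \<omega>, of z]
    by (simp add: \<mu>_def spherical_density_def)
qed

lemma \<mu>_nonneg: "s > 0 \<Longrightarrow> \<mu> s z \<ge> 0"
  by (simp add: \<mu>_def spherical_density_nonneg)

lemma \<mu>_continuous:
  assumes "s > 0"
  shows "continuous_on UNIV (\<mu> s)"
proof -
  define A where "A = {z. z - a \<notin> \<Lambda>}"
  define B where "B = {z. z - b \<notin> \<Lambda>}"
  have op: "open A" "open B" unfolding A_def B_def by (rule open_off)+
  have "continuous_on A (\<mu> s)"
    by (rule continuous_on_cong[THEN iffD1, OF refl _ continuous_on_spherical_density[OF op(1)]])
       (use F_hol assms in \<open>auto simp: A_def \<mu>_def\<close>)
  moreover have "continuous_on B (\<mu> s)"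
    by (rule continuous_on_cong[THEN iffD1, OF refl _ continuous_on_spherical_density[OF op(2), of H "1 / s"]])
       (use H_hol assms \<mu>_via_H in \<open>auto simp: B_def\<close>)
  ultimately have "continuous_on (A \<union> B) (\<mu> s)" using op by (intro continuous_on_open_Un)
  moreover have "A \<union> B = UNIV" using disjoint by (auto simp: A_def B_def)
  ultimately show ?thesis by simp
qed

lemma laplacian_\<phi>:
  assumes "s > 0" "t > 0"
  shows "laplacian (\<phi> s t) z = \<mu> s z - \<mu> t z"
proof (cases "z - a \<in> \<Lambda>")
  case True
  define V where "V = {z. z - b \<notin> \<Lambda>}"
  have V: "open V" "z \<in> V" "H holomorphic_on V" using open_off disjoint[OF True] H_hol by (auto simp: V_def)
  have sm: "smooth_upto 2 V (log_reg (1 / s) H)" "smooth_upto 2 V (log_reg (1 / t) H)"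
    using assms by (intro smooth_upto_log_reg V; simp)+
  have "laplacian (\<phi> s t) z = laplacian (\<lambda>z. log_reg (1 / s) H z - log_reg (1 / t) H z + (ln s - ln t) / 2) z"
    by (rule laplacian_cong[OF V(1,2) _ smooth_upto_affine_diff[OF V(1) sm]])
       (use \<phi>_via_H assms in \<open>auto simp: V_def\<close>)
  also have "\<dots> = laplacian (log_reg (1 / s) H) z - laplacian (log_reg (1 / t) H) z"
    by (rule laplacian_affine_diff[OF V(1,2) sm])
  also have "\<dots> = \<mu> s z - \<mu> t z"
    using laplacian_log_reg[OF V(1,3) _ V(2)] assms True by (simp add: \<mu>_def)
  finally show ?thesis .
next
  case False
  define V where "V = {z. z - a \<notin> \<Lambda>}"
  have V: "open V" "z \<in> V" "F holomorphic_on V" using open_off False F_hol by (auto simp: V_def)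
  have sm: "smooth_upto 2 V (log_reg s F)" "smooth_upto 2 V (log_reg t F)"
    using assms by (intro smooth_upto_log_reg V; simp)+
  have "laplacian (\<phi> s t) z = laplacian (\<lambda>z. log_reg s F z - log_reg t F z + 0) z"
    by (rule laplacian_cong[OF V(1,2) _ smooth_upto_affine_diff[OF V(1) sm]])
       (auto simp: V_def \<phi>_def)
  also have "\<dots> = laplacian (log_reg s F) z - laplacian (log_reg t F) z"
    by (rule laplacian_affine_diff[OF V(1,2) sm])
  also have "\<dots> = \<mu> s z - \<mu> t z"
    using laplacian_log_reg[OF V(1,3) _ V(2)] assms False by (simp add: \<mu>_def)
  finally show ?thesis .
qed

definition mass :: real where "mass = TI (\<mu> 1)"

lemma \<mu>_torus_integrable: "s > 0 \<Longrightarrow> torus_integrable (\<mu> s)"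
  by (intro continuous_torus_integrable \<mu>_continuous)

text \<open>
  The difference of two of these densities is the Laplacian of a smooth periodic function.
\<close>
lemma torus_integral_\<mu>:
  assumes "s > 0"
  shows "TI (\<mu> s) = mass"
proof -
  have "TI (laplacian (\<phi> s 1)) = 0"
    using assms by (intro torus_integral_laplacian_0 \<phi>_smooth \<phi>_periodic) simp_all
  moreover have "laplacian (\<phi> s 1) = (\<lambda>z. \<mu> s z - \<mu> 1 z)"
    using laplacian_\<phi>[OF assms, of 1] by auto
  ultimately show ?thesis
    using torus_integral_diff[OF \<mu>_torus_integrable[OF assms] \<mu>_torus_integrable[of 1]]
    by (simp add: mass_def)
qed

lemma mass_nonneg: "mass \<ge> 0"
  unfolding mass_def torus_integral_def set_lebesgue_integral_def
  by (intro integral_nonneg_AE AE_I2) (simp add: \<mu>_nonneg)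

text \<open>
  Periodicity reduces the claim to the part of the closed parallelogram that keeps the distance \<open>\<delta>\<close>
  from \<open>d + \<Lambda>\<close>, which is compact.
\<close>
lemma deriv_bounded_away:
  assumes h: "h holomorphic_on {z. z - d \<notin> \<Lambda>}" "lattice_periodic \<omega>1 \<omega>2 h" and \<delta>: "\<delta> > 0"
  obtains B where "\<And>z. (\<And>\<omega>. \<omega> \<in> \<Lambda> \<Longrightarrow> dist z (d + \<omega>) \<ge> \<delta>) \<Longrightarrow> norm (deriv h z) \<le> B"
proof -
  define A where "A = {z. \<forall>\<omega>\<in>\<Lambda>. dist z (d + \<omega>) \<ge> \<delta>}"
  have "A = (\<Inter>\<omega>\<in>\<Lambda>. {z. \<delta> \<le> dist z (d + \<omega>)})" by (auto simp: A_def)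
  then have "closed A" by (auto intro!: closed_INT closed_Collect_le continuous_intros)
  then have comp: "compact (closed_parallelogram \<inter> A)"
    by (intro compact_Int_closed compact_closed_parallelogram)
  have off: "z - d \<notin> \<Lambda>" if "z \<in> A" for z
  proof
    assume "z - d \<in> \<Lambda>"
    then have "dist z (d + (z - d)) \<ge> \<delta>" using that unfolding A_def by blast
    then show False using \<delta> by simp
  qed
  have "continuous_on {z. z - d \<notin> \<Lambda>} (deriv h)"
    by (intro holomorphic_on_imp_continuous_on holomorphic_deriv h open_off)
  then have "continuous_on (closed_parallelogram \<inter> A) (deriv h)"
    by (rule continuous_on_subset) (use off in auto)
  then have "bounded (deriv h ` (closed_parallelogram \<inter> A))"
    using comp by (intro compact_imp_bounded compact_continuous_image)
  then obtain B where B: "\<And>z. z \<in> closed_parallelogram \<Longrightarrow> z \<in> A \<Longrightarrow> norm (deriv h z) \<le> B"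
    by (auto simp: bounded_iff)
  show ?thesis
  proof (rule that)
    fix z assume "\<And>\<omega>. \<omega> \<in> \<Lambda> \<Longrightarrow> dist z (d + \<omega>) \<ge> \<delta>"
    then have z: "z \<in> A" by (simp add: A_def)
    obtain \<omega> where \<omega>: "\<omega> \<in> \<Lambda>" "z + \<omega> \<in> P" by (rule reduce_to_parallelogram)
    have "z + \<omega> \<in> A"
      unfolding A_def
    proof (intro CollectI ballI)
      fix \<eta> assume "\<eta> \<in> \<Lambda>"
      then have "dist z (d + (\<eta> - \<omega>)) \<ge> \<delta>" using z lattice_diff[OF _ \<omega>(1)] unfolding A_def by blast
      then show "dist (z + \<omega>) (d + \<eta>) \<ge> \<delta>" by (simp add: dist_norm algebra_simps)
    qed
    then have "norm (deriv h (z + \<omega>)) \<le> B" using B \<omega>(2) parallelogram_subset by blast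
    then show "norm (deriv h z) \<le> B" using deriv_periodic[OF h \<omega>(1) off[OF z]] by simp
  qed
qed

text \<open>
  Away from the zeros of \<open>F\<close> the density is at most \<open>2 s |H'|\<^sup>2\<close>, with \<open>H'\<close> bounded there.
\<close>
lemma \<mu>_concentrates_at_zero:
  assumes K: "torus_integrable K" "lattice_periodic \<omega>1 \<omega>2 K" "isCont K b"
  shows "torus_integrable (\<lambda>z. K z * \<mu> (1 / real (Suc n)) z)"
    and "(\<lambda>n. TI (\<lambda>z. K z * \<mu> (1 / real (Suc n)) z)) \<longlonglongrightarrow> mass * K b"
proof -
  have away: "\<exists>S. S \<longlonglongrightarrow> 0 \<and> (\<forall>n z. (\<forall>\<omega>\<in>\<Lambda>. dist z (b + \<omega>) \<ge> \<delta>) \<longrightarrow> \<mu> (1 / real (Suc n)) z \<le> S n)"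
    if \<delta>: "\<delta> > 0" for \<delta>
  proof -
    obtain B where B: "\<And>z. (\<And>\<omega>. \<omega> \<in> \<Lambda> \<Longrightarrow> dist z (b + \<omega>) \<ge> \<delta>) \<Longrightarrow> norm (deriv H z) \<le> B"
      using deriv_bounded_away[OF H_hol H_periodic \<delta>] by metis
    have "(\<lambda>n. 2 * inverse (real (Suc n)) * B\<^sup>2) \<longlonglongrightarrow> 2 * 0 * B\<^sup>2"
      by (intro tendsto_intros LIMSEQ_inverse_real_of_nat)
    then have "(\<lambda>n. 2 * inverse (real (Suc n)) * B\<^sup>2) \<longlonglongrightarrow> 0" by simp
    moreover have "\<mu> (1 / real (Suc n)) z \<le> 2 * inverse (real (Suc n)) * B\<^sup>2"
      if z: "\<forall>\<omega>\<in>\<Lambda>. dist z (b + \<omega>) \<ge> \<delta>" for n z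
    proof -
      have off: "z - b \<notin> \<Lambda>"
      proof
        assume "z - b \<in> \<Lambda>"
        then have "dist z (b + (z - b)) \<ge> \<delta>" using z by blast
        then show False using \<delta> by simp
      qed
      have "\<mu> (1 / real (Suc n)) z = spherical_density (real (Suc n)) H z"
        using \<mu>_via_H[OF off, of "1 / real (Suc n)"] by (simp del: of_nat_Suc)
      also have "\<dots> \<le> 2 / real (Suc n) * (norm (deriv H z))\<^sup>2" by (rule spherical_density_le) simp
      also have "\<dots> \<le> 2 / real (Suc n) * B\<^sup>2"
        using B z by (intro mult_left_mono power_mono) auto
      finally show ?thesis by (simp add: divide_inverse)
    qed
    ultimately show ?thesis by blast
  qed
  have pos: "1 / real (Suc n) > 0" for n by simp
  note * = torus_integral_concentrated[of K b "\<lambda>n. \<mu> (1 / real (Suc n))" mass,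
      OF K \<mu>_continuous[OF pos] \<mu>_periodic \<mu>_nonneg[OF pos] torus_integral_\<mu>[OF pos]]
  show "torus_integrable (\<lambda>z. K z * \<mu> (1 / real (Suc n)) z)"
    by (rule *(1)) (rule away)
  show "(\<lambda>n. TI (\<lambda>z. K z * \<mu> (1 / real (Suc n)) z)) \<longlonglongrightarrow> mass * K b"
    by (rule *(2)) (rule away)
qed

text \<open>
  Away from the poles of \<open>F\<close> the density is at most \<open>2 |F'|\<^sup>2 / s\<close>, with \<open>F'\<close> bounded there.
\<close>
lemma \<mu>_concentrates_at_pole:
  assumes K: "torus_integrable K" "lattice_periodic \<omega>1 \<omega>2 K" "isCont K a"
  shows "torus_integrable (\<lambda>z. K z * \<mu> (real (Suc n)) z)"
    and "(\<lambda>n. TI (\<lambda>z. K z * \<mu> (real (Suc n)) z)) \<longlonglongrightarrow> mass * K a"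
proof -
  have away: "\<exists>S. S \<longlonglongrightarrow> 0 \<and> (\<forall>n z. (\<forall>\<omega>\<in>\<Lambda>. dist z (a + \<omega>) \<ge> \<delta>) \<longrightarrow> \<mu> (real (Suc n)) z \<le> S n)"
    if \<delta>: "\<delta> > 0" for \<delta>
  proof -
    obtain B where B: "\<And>z. (\<And>\<omega>. \<omega> \<in> \<Lambda> \<Longrightarrow> dist z (a + \<omega>) \<ge> \<delta>) \<Longrightarrow> norm (deriv F z) \<le> B"
      using deriv_bounded_away[OF F_hol F_periodic \<delta>] by metis
    have "(\<lambda>n. 2 * inverse (real (Suc n)) * B\<^sup>2) \<longlonglongrightarrow> 2 * 0 * B\<^sup>2"
      by (intro tendsto_intros LIMSEQ_inverse_real_of_nat)
    then have "(\<lambda>n. 2 * inverse (real (Suc n)) * B\<^sup>2) \<longlonglongrightarrow> 0" by simp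
    moreover have "\<mu> (real (Suc n)) z \<le> 2 * inverse (real (Suc n)) * B\<^sup>2"
      if z: "\<forall>\<omega>\<in>\<Lambda>. dist z (a + \<omega>) \<ge> \<delta>" for n z
    proof -
      have off: "z - a \<notin> \<Lambda>"
      proof
        assume "z - a \<in> \<Lambda>"
        then have "dist z (a + (z - a)) \<ge> \<delta>" using z by blast
        then show False using \<delta> by simp
      qed
      have "\<mu> (real (Suc n)) z = spherical_density (real (Suc n)) F z"
        using off by (simp add: \<mu>_def del: of_nat_Suc)
      also have "\<dots> \<le> 2 / real (Suc n) * (norm (deriv F z))\<^sup>2" by (rule spherical_density_le) simp
      also have "\<dots> \<le> 2 / real (Suc n) * B\<^sup>2"
        using B z by (intro mult_left_mono power_mono) auto
      finally show ?thesis by (simp add: divide_inverse)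
    qed
    ultimately show ?thesis by blast
  qed
  have pos: "real (Suc n) > 0" for n by simp
  note * = torus_integral_concentrated[of K a "\<lambda>n. \<mu> (real (Suc n))" mass,
      OF K \<mu>_continuous[OF pos] \<mu>_periodic \<mu>_nonneg[OF pos] torus_integral_\<mu>[OF pos]]
  show "torus_integrable (\<lambda>z. K z * \<mu> (real (Suc n)) z)"
    by (rule *(1)) (rule away)
  show "(\<lambda>n. TI (\<lambda>z. K z * \<mu> (real (Suc n)) z)) \<longlonglongrightarrow> mass * K a"
    by (rule *(2)) (rule away)
qed

text \<open>
  The translation by \<open>c\<close> replaces \<open>F\<close> by \<open>1/F\<close>, and
  \<open>(1/x + s) / (1/x + 1/s) = s\<^sup>2 (x + 1/s) / (x + s)\<close> for \<open>x = |F|\<^sup>2\<close>.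
\<close>
lemma \<phi>_flip:
  assumes "s > 0"
  shows "\<phi> s (1 / s) (z + c) = ln s - \<phi> s (1 / s) z"
proof (cases "z - b \<in> \<Lambda>")
  case True
  then have "z - a \<notin> \<Lambda>" using disjoint by blast
  then have "\<phi> s (1 / s) z = ln s"
    using F_zero[OF True] assms by (simp add: \<phi>_def log_reg_def ln_div)
  then show ?thesis using True by (simp add: \<phi>_def pole_shift)
next
  case False
  have "\<phi> s (1 / s) (z + c) = log_reg s H z - log_reg (1 / s) H z"
    using False by (simp add: \<phi>_def pole_shift log_reg_def F_shift)
  moreover have "\<phi> s (1 / s) z = log_reg (1 / s) H z - log_reg s H z + ln s"
    using \<phi>_via_H[OF False assms, of "1 / s"] assms by (simp add: ln_div)
  ultimately show ?thesis by simp
qed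

lemma torus_integral_const: "TI (\<lambda>_. k) = k * torus_area \<omega>1 \<omega>2"
  unfolding torus_integral_def torus_area_def set_lebesgue_integral_def by simp

text \<open>
  The translation by \<open>c\<close> preserves the integral and turns \<open>\<phi>\<close> into \<open>ln s - \<phi>\<close>.
\<close>
lemma torus_integral_\<phi>:
  assumes "s > 0"
  shows "TI (\<phi> s (1 / s)) = ln s / 2 * torus_area \<omega>1 \<omega>2"
proof -
  define f where "f = \<phi> s (1 / s)"
  have sm: "smooth_fun f" unfolding f_def using assms by (intro \<phi>_smooth) auto
  then have "continuous_on UNIV f"
    unfolding smooth_fun_def
    by (auto intro!: continuous_at_imp_continuous_on differentiable_imp_continuous_within dest!: bspec[of _ _ "[]"])
  then have fi: "torus_integrable f" by (rule continuous_torus_integrable)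
  have "TI f = TI (\<lambda>z. f (z + c))"
    unfolding f_def using torus_shift(2)[OF \<phi>_periodic fi[unfolded f_def]] by simp
  also have "\<dots> = TI (\<lambda>z. ln s - f z)" using \<phi>_flip[OF assms] by (simp add: f_def)
  also have "\<dots> = TI (\<lambda>_. ln s) - TI f"
    by (rule torus_integral_diff[OF continuous_torus_integrable fi]) simp
  finally show ?thesis by (simp add: torus_integral_const f_def field_simps)
qed

text \<open>
  The equation for the Green function is tested with \<open>\<phi>\<^sub>s\<^sub>,\<^sub>1\<^sub>/\<^sub>s\<close> for \<open>s = 1 / (n + 1)\<close>. On the left the
  densities concentrate at \<open>a\<close> and \<open>b\<close>; on the right, after subtraction of the mean \<open>ln s / 2\<close>, one
  is left with \<open>1/2 ln ((y + s) / (1 + s y))\<close> for \<open>y = |F(w)|\<^sup>2\<close>, which tends to \<open>ln |F(w)|\<close>.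
\<close>
lemma green_function_difference:
  assumes G: "is_green_function \<omega>1 \<omega>2 G" and w: "w - a \<notin> \<Lambda>" "w - b \<notin> \<Lambda>"
  shows "mass * (G a w - G b w) = ln (norm (F w))"
proof -
  define K where "K = (\<lambda>z. G z w)"
  have K: "torus_integrable K" "lattice_periodic \<omega>1 \<omega>2 K" "continuous_on {z. z - w \<notin> \<Lambda>} K"
    and green: "\<And>f. smooth_fun f \<Longrightarrow> lattice_periodic \<omega>1 \<omega>2 f \<Longrightarrow>
      - TI (\<lambda>z. K z * laplacian f z) = f w - TI f / torus_area \<omega>1 \<omega>2"
    using G unfolding is_green_function_def K_def by blast+
  have "isCont K d" if "w - d \<notin> \<Lambda>" for d
  proof -
    have "d - w \<notin> \<Lambda>" using lattice_minus[of "d - w"] that by auto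
    then show ?thesis using K(3) open_off by (simp add: continuous_on_eq_continuous_at)
  qed
  then have cont: "isCont K a" "isCont K b" using w by auto
  \<comment> \<open>With \<open>x / 0 = 0\<close>, the equation tested with the constant \<open>1\<close> would read \<open>0 = 1\<close>.\<close>
  have area: "torus_area \<omega>1 \<omega>2 \<noteq> 0"
  proof
    assume 0: "torus_area \<omega>1 \<omega>2 = 0"
    have "smooth_fun (\<lambda>_. 1)" by (simp add: smooth_fun_iff_smooth_upto smooth_upto_const)
    moreover have "laplacian (\<lambda>_. 1) z = 0" for z
      by (simp add: laplacian_def)
    ultimately show False using green[of "\<lambda>_. 1"] 0
      by (simp add: lattice_periodic_def torus_integral_def)
  qed
  define y where "y = (norm (F w))\<^sup>2"
  have "F w \<noteq> 0" using reciprocal[OF w] by auto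
  then have y: "y > 0" by (simp add: y_def)
  have eq: "TI (\<lambda>z. K z * \<mu> (real (Suc n)) z) - TI (\<lambda>z. K z * \<mu> (1 / real (Suc n)) z)
      = (ln (y + 1 / real (Suc n)) - ln (1 + y * (1 / real (Suc n)))) / 2" for n
  proof -
    define s where "s = 1 / real (Suc n)"
    have s: "s > 0" "1 / s = real (Suc n)" by (simp_all add: s_def)
    have "TI (\<lambda>z. K z * laplacian (\<phi> s (1 / s)) z) = TI (\<lambda>z. K z * \<mu> s z - K z * \<mu> (1 / s) z)"
      using laplacian_\<phi>[of s "1 / s"] s(1) by (simp add: right_diff_distrib)
    also have "\<dots> = TI (\<lambda>z. K z * \<mu> s z) - TI (\<lambda>z. K z * \<mu> (1 / s) z)"
      using \<mu>_concentrates_at_zero(1)[OF K(1,2) cont(2), of n, folded s_def]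
        \<mu>_concentrates_at_pole(1)[OF K(1,2) cont(1), of n]
      unfolding s(2) by (rule torus_integral_diff)
    finally have "TI (\<lambda>z. K z * \<mu> (1 / s) z) - TI (\<lambda>z. K z * \<mu> s z) = \<phi> s (1 / s) w - ln s / 2"
      using green[OF \<phi>_smooth \<phi>_periodic, of s "1 / s"] s(1) area by (simp add: torus_integral_\<phi>)
    also have "\<dots> = (ln (y + s) - ln (y + 1 / s)) / 2 - ln s / 2"
      using w by (simp add: \<phi>_def log_reg_def y_def diff_divide_distrib)
    also have "ln (y + 1 / s) = ln ((1 + y * s) / s)"
      using s(1) by (simp add: field_simps)
    also have "\<dots> = ln (1 + y * s) - ln s"
    proof -
      have "1 + y * s > 0" using s(1) y by (simp add: add_pos_pos)
      then show ?thesis using s(1) by (simp add: ln_div)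
    qed
    finally show ?thesis unfolding s(2) s_def[symmetric] by argo
  qed
  have "(\<lambda>n. TI (\<lambda>z. K z * \<mu> (real (Suc n)) z) - TI (\<lambda>z. K z * \<mu> (1 / real (Suc n)) z))
      \<longlonglongrightarrow> mass * K a - mass * K b"
    by (intro tendsto_diff \<mu>_concentrates_at_zero(2) \<mu>_concentrates_at_pole(2) K cont)
  moreover have "(\<lambda>n. (ln (y + 1 / real (Suc n)) - ln (1 + y * (1 / real (Suc n)))) / 2)
      \<longlonglongrightarrow> (ln (y + 0) - ln (1 + y * 0)) / 2"
  proof -
    have "(\<lambda>n. 1 / real (Suc n)) \<longlonglongrightarrow> 0" using LIMSEQ_inverse_real_of_nat by (simp add: divide_inverse)
    then show ?thesis using y by (intro tendsto_intros) auto
  qed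
  ultimately have "mass * K a - mass * K b = (ln (y + 0) - ln (1 + y * 0)) / 2"
    unfolding eq using LIMSEQ_unique by blast
  also have "\<dots> = ln (norm (F w))" using \<open>F w \<noteq> 0\<close> by (simp add: y_def ln_realpow)
  finally show ?thesis by (simp add: K_def right_diff_distrib)
qed

text \<open>
  If the mass were \<open>0\<close>, then \<open>|F(w)| = 1\<close> for all \<open>w\<close> off the zeros and poles, which fails near \<open>b\<close>.
\<close>
lemma mass_pos:
  assumes G: "is_green_function \<omega>1 \<omega>2 G"
  shows "mass > 0"
proof -
  have "b - a \<notin> \<Lambda>" using disjoint[of b] by auto
  then have cont: "isCont F b"
    using holomorphic_on_imp_continuous_on[OF F_hol] open_off[of a]
    by (simp add: continuous_on_eq_continuous_at)
  have "F b = 0" by (rule F_zero) simp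
  then have "eventually (\<lambda>w. norm (F w) < 1) (at b)"
    using tendsto_norm[OF cont[unfolded isCont_def]] by (intro order_tendstoD(2)) auto
  moreover have "eventually (\<lambda>w. w \<in> {w. w - a \<notin> \<Lambda>}) (at b)"
    using eventually_at_in_open'[OF open_off[of a], of b] \<open>b - a \<notin> \<Lambda>\<close> by simp
  moreover have "eventually (\<lambda>w. w - b \<notin> \<Lambda>) (at b)"
  proof -
    have "eventually (\<lambda>h. h \<in> - (\<Lambda> - {0})) (nhds 0)"
      by (intro eventually_nhds_in_open open_Compl closed_lattice_subset) auto
    then show ?thesis unfolding eventually_at_to_0[of _ b]
      by (auto simp: eventually_at_filter elim: eventually_mono)
  qed
  ultimately have "eventually (\<lambda>w. norm (F w) < 1 \<and> w - a \<notin> \<Lambda> \<and> w - b \<notin> \<Lambda>) (at b)"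
    by eventually_elim auto
  then obtain w where w: "norm (F w) < 1" "w - a \<notin> \<Lambda>" "w - b \<notin> \<Lambda>"
    using eventually_happens[of _ "at b"] by auto
  then have "F w \<noteq> 0" using reciprocal[OF w(2,3)] by auto
  then have "ln (norm (F w)) \<noteq> 0" using w(1) by simp
  then have "mass \<noteq> 0" using green_function_difference[OF G w(2,3)] by auto
  then show ?thesis using mass_nonneg by simp
qed

end

section \<open>Comparison of the Green function at two half periods\<close>

context complex_lattice
begin

text \<open>
  The function is \<open>k (\<wp>(z - a) - e(c))\<close> for \<open>c = a + b\<close>, where \<open>\<kappa> = (e(a) - e(c)) (e(b) - e(c))\<close> is
  the constant product at the half period \<open>c\<close> and \<open>k\<^sup>2 \<kappa> = 1\<close>. This choice of \<open>k\<close> also determines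
  the size of \<open>F\<close> at the origin.
\<close>
lemma reciprocal_pair_exists:
  assumes a: "half_period a" and b: "half_period b" and ab: "a - b \<notin> \<Lambda>"
  shows "\<exists>F H. reciprocal_pair \<omega>1 \<omega>2 F H a b (a + b) \<and>
    norm (F 0) ^ 2 * norm (wp b - wp (a + b)) = norm (wp a - wp (a + b)) \<and>
    wp b \<noteq> wp (a + b)"
proof -
  define c where "c = a + b"
  have a2: "2 * a \<in> \<Lambda>" "a \<notin> \<Lambda>" and b2: "2 * b \<in> \<Lambda>" "b \<notin> \<Lambda>"
    using a b by (auto simp: half_period_def)
  have c2: "2 * c \<in> \<Lambda>" using lattice_add[OF a2(1) b2(1)] by (simp add: c_def distrib_left)
  have "c \<notin> \<Lambda>"
  proof
    assume "c \<in> \<Lambda>"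
    then have "c - 2 * b \<in> \<Lambda>" using b2(1) by (rule lattice_diff)
    then show False using ab by (simp add: c_def)
  qed
  with c2 have c: "half_period c" by (simp add: half_period_def)
  obtain \<kappa> where \<kappa>: "\<kappa> \<noteq> 0"
    "\<And>z. z \<notin> \<Lambda> \<Longrightarrow> z + c \<notin> \<Lambda> \<Longrightarrow> (wp z - wp c) * (wp (z + c) - wp c) = \<kappa>"
    by (rule wp_half_period_product[OF c]) blast
  define k where "k = csqrt (1 / \<kappa>)"
  have k: "k * k * \<kappa> = 1" using \<kappa>(1) power2_csqrt[of "1 / \<kappa>"] by (simp add: k_def power2_eq_square)
  define F where "F = (\<lambda>z. k * (wp (z + - a) - wp c))"
  define H where "H = (\<lambda>z. F (z + c))"
  have zb: "z + - a + c \<in> \<Lambda> \<longleftrightarrow> z - b \<in> \<Lambda>" for z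
    using lattice_add_iff[OF b2(1), of "z - b"] by (simp add: c_def algebra_simps)
  have cb: "z + c - a \<in> \<Lambda> \<longleftrightarrow> z - b \<in> \<Lambda>" for z using zb[of z] by (simp add: algebra_simps)
  have F_hol: "F holomorphic_on {z. z - a \<notin> \<Lambda>}"
    unfolding F_def using wp_shift_holomorphic[of "- a"] by (intro holomorphic_intros) simp
  have Fper: "lattice_periodic \<omega>1 \<omega>2 F"
    unfolding lattice_periodic_def
  proof (intro allI ballI)
    fix z \<omega> assume "\<omega> \<in> \<Lambda>"
    then have "wp (z + \<omega> + - a) = wp (z + - a)" by (intro wp_cong) simp
    then show "F (z + \<omega>) = F z" by (simp add: F_def)
  qed
  have "reciprocal_pair \<omega>1 \<omega>2 F H a b (a + b)"
  proof unfold_locales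
    show "F holomorphic_on {z. z - a \<notin> \<Lambda>}" by fact
    have "(F \<circ> (\<lambda>z. z + c)) holomorphic_on {z. z - b \<notin> \<Lambda>}"
      by (rule holomorphic_on_compose_gen[OF _ F_hol]) (use cb in \<open>auto intro!: holomorphic_intros\<close>)
    then show "H holomorphic_on {z. z - b \<notin> \<Lambda>}" by (simp add: H_def o_def)
    show "F z * H z = 1" if "z - a \<notin> \<Lambda>" "z - b \<notin> \<Lambda>" for z
    proof -
      have "F z * H z = k * k * ((wp (z + - a) - wp c) * (wp (z + - a + c) - wp c))"
        by (simp add: F_def H_def algebra_simps)
      also have "\<dots> = k * k * \<kappa>" using \<kappa>(2)[of "z + - a"] that zb by simp
      finally show ?thesis using k by simp
    qed
    show "F z = 0" if "z - b \<in> \<Lambda>" for z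
    proof -
      have "wp (z + - a) = wp c"
        by (rule wp_cong) (use lattice_diff[OF that a2(1)] in \<open>simp add: c_def algebra_simps\<close>)
      then show ?thesis by (simp add: F_def)
    qed
    show "H z = 0" if "z - a \<in> \<Lambda>" for z
    proof -
      have "wp (z + c + - a) = wp c" by (rule wp_cong) (use that in \<open>simp add: algebra_simps\<close>)
      then show ?thesis by (simp add: H_def F_def)
    qed
    show "a - b \<notin> \<Lambda>" by fact
    show "lattice_periodic \<omega>1 \<omega>2 F" by fact
    show "lattice_periodic \<omega>1 \<omega>2 H" unfolding H_def by (rule lattice_periodic_shift[OF Fper])
    show "F (z + (a + b)) = H z" for z by (simp add: H_def c_def)
    show "z + (a + b) - a \<in> \<Lambda> \<longleftrightarrow> z - b \<in> \<Lambda>" for z using cb[of z] by (simp add: c_def)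
  qed
  moreover have "norm (F 0) ^ 2 * norm (wp b - wp c) = norm (wp a - wp c) \<and> wp b \<noteq> wp c"
  proof -
    have "wp (a + c) = wp b" by (rule wp_cong) (use a2 in \<open>simp add: c_def\<close>)
    moreover have "a + c \<notin> \<Lambda>"
      using lattice_add_iff[OF a2(1), of b] b2(2) by (simp add: c_def algebra_simps)
    ultimately have prod: "(wp a - wp c) * (wp b - wp c) = \<kappa>" using \<kappa>(2)[OF a2(2)] by simp
    define x where "x = wp a - wp c"
    define y where "y = wp b - wp c"
    have "F 0 = k * x" by (simp add: F_def x_def wp_even)
    then have "(F 0)\<^sup>2 * y = k * k * (x * y) * x" by (simp add: power2_eq_square)
    also have "\<dots> = x" using k prod by (simp add: x_def y_def)
    finally have "norm ((F 0)\<^sup>2 * y) = norm x" by simp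
    then show ?thesis using prod \<kappa>(1) by (auto simp: norm_mult norm_power x_def y_def)
  qed
  ultimately show ?thesis unfolding c_def by blast
qed

text \<open>
  Substituting \<open>z = - x - y\<close>, the mixed terms of \<open>|2 x + y|\<^sup>2\<close> and \<open>|x + 2 y|\<^sup>2\<close> agree.
\<close>
lemma norm_le_iff_of_sum_zero:
  fixes x y z :: complex
  assumes "x + y + z = 0"
  shows "norm (y - z) \<le> norm (x - z) \<longleftrightarrow> norm y \<le> norm x"
proof -
  have z: "z = - x - y" using assms by (simp add: eq_neg_iff_add_eq_0 algebra_simps)
  have "(norm (x - z))\<^sup>2 - (norm (y - z))\<^sup>2 = 3 * ((norm x)\<^sup>2 - (norm y)\<^sup>2)"
    unfolding z cmod_power2 by (simp add: power2_eq_square algebra_simps)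
  moreover have "r \<le> p \<longleftrightarrow> u \<le> t" if "p - r = 3 * (t - u)" for p r t u :: real
    using that by auto
  ultimately have "(norm (y - z))\<^sup>2 \<le> (norm (x - z))\<^sup>2 \<longleftrightarrow> (norm y)\<^sup>2 \<le> (norm x)\<^sup>2"
    by blast
  then show ?thesis by (simp add: power2_le_iff_abs_le)
qed

lemma green_function_half_periods_compare:
  assumes G: "is_green_function \<omega>1 \<omega>2 G"
    and a: "half_period a" and b: "half_period b" and ab: "a - b \<notin> \<Lambda>"
    and sum: "wp a + wp b + wp (a + b) = 0"
  shows "G b 0 \<le> G a 0 \<longleftrightarrow> norm (wp b) \<le> norm (wp a)"
proof -
  obtain F H where FH: "reciprocal_pair \<omega>1 \<omega>2 F H a b (a + b)"
    and F0: "norm (F 0) ^ 2 * norm (wp b - wp (a + b)) = norm (wp a - wp (a + b))"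
    and neq: "wp b \<noteq> wp (a + b)"
    using reciprocal_pair_exists[OF a b ab] by blast
  interpret reciprocal_pair \<omega>1 \<omega>2 F H a b "a + b" by (rule FH)
  have off: "0 - a \<notin> \<Lambda>" "0 - b \<notin> \<Lambda>"
    using a b lattice_minus[of "- a"] lattice_minus[of "- b"] by (auto simp: half_period_def)
  have eq: "mass * (G a 0 - G b 0) = ln (norm (F 0))" by (rule green_function_difference[OF G off])
  have pos: "mass > 0" by (rule mass_pos[OF G])
  have F0nz: "norm (F 0) > 0" using reciprocal[OF off] by auto
  have "G b 0 \<le> G a 0 \<longleftrightarrow> 0 \<le> mass * (G a 0 - G b 0)" using pos by (simp add: zero_le_mult_iff)
  also have "\<dots> \<longleftrightarrow> 1 \<le> norm (F 0)" unfolding eq using F0nz by simp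
  also have "\<dots> \<longleftrightarrow> norm (wp b - wp (a + b)) \<le> norm (wp a - wp (a + b))"
  proof -
    have "norm (wp b - wp (a + b)) > 0" using neq by simp
    then have "norm (wp b - wp (a + b)) \<le> norm (F 0) ^ 2 * norm (wp b - wp (a + b)) \<longleftrightarrow> 1 \<le> norm (F 0) ^ 2"
      by simp
    then show ?thesis unfolding F0 using abs_le_square_iff[of 1 "norm (F 0)"] by simp
  qed
  also have "\<dots> \<longleftrightarrow> norm (wp b) \<le> norm (wp a)" by (rule norm_le_iff_of_sum_zero[OF sum])
  finally show ?thesis .
qed

end

theorem theorem1p5:
  fixes \<omega>1 \<omega>2 z0 z1 :: complex
    and G :: "complex \<Rightarrow> complex \<Rightarrow> real"
  assumes "\<omega>1 \<noteq> \<omega>2" and "independent {\<omega>1, \<omega>2}"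
    and "is_green_function \<omega>1 \<omega>2 G"
    and "z0 \<in> half_period_points \<omega>1 \<omega>2"
    and "z1 \<in> half_period_points \<omega>1 \<omega>2"
  shows "G z0 0 \<ge> G z1 0 \<longleftrightarrow>
           norm (weierstrass_p \<omega>1 \<omega>2 z0) \<ge> norm (weierstrass_p \<omega>1 \<omega>2 z1)"
proof -
  interpret complex_lattice \<omega>1 \<omega>2
  proof
    have nz: "\<omega>1 \<noteq> 0" using assms(2) dependent_zero[of "{\<omega>1, \<omega>2}"] by auto
    show "Im (cnj \<omega>1 * \<omega>2) \<noteq> 0"
    proof
      assume "Im (cnj \<omega>1 * \<omega>2) = 0"
      then have "cnj \<omega>1 * \<omega>2 = of_real (Re (cnj \<omega>1 * \<omega>2))" by (simp add: complex_eq_iff)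
      then have "\<omega>1 * cnj \<omega>1 * \<omega>2 = of_real (Re (cnj \<omega>1 * \<omega>2)) * \<omega>1" by (simp add: mult_ac)
      then have "of_real ((norm \<omega>1)\<^sup>2) * \<omega>2 = of_real (Re (cnj \<omega>1 * \<omega>2)) * \<omega>1"
        by (simp only: complex_norm_square)
      then have "\<omega>2 = (Re (cnj \<omega>1 * \<omega>2) / (norm \<omega>1)\<^sup>2) *\<^sub>R \<omega>1"
        using nz by (simp add: scaleR_conv_of_real field_simps)
      then have "\<omega>2 \<in> span ({\<omega>1, \<omega>2} - {\<omega>2})"
        using assms(1) by (metis insertI1 insert_Diff_if singletonD span_base span_scale empty_iff)
      then show False using assms(2) unfolding dependent_def by blast
    qed
  qed
  define a where "a = \<omega>1 / 2"
  define b where "b = \<omega>2 / 2"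
  define d where "d = (\<omega>1 + \<omega>2) / 2"
  have hp: "half_period a" "half_period b" "half_period d"
    using half_period_generators by (simp_all add: a_def b_def d_def)
  have distinct: "a - b \<notin> \<Lambda>" "a - d \<notin> \<Lambda>" "b - d \<notin> \<Lambda>" "b - a \<notin> \<Lambda>" "d - a \<notin> \<Lambda>" "d - b \<notin> \<Lambda>"
    unfolding lattice_iff a_def b_def d_def by (simp_all add: half_not_Int)
  have e: "wp (a + b) = wp d" "wp (a + d) = wp b" "wp (b + d) = wp a"
    by (rule wp_cong; simp add: lattice_iff a_def b_def d_def)+
  have e': "wp (b + a) = wp d" "wp (d + a) = wp b" "wp (d + b) = wp a"
    using e by (simp_all add: add.commute)
  have sum: "wp a + wp b + wp d = 0" using wp_half_periods_sum by (simp add: a_def b_def d_def)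
  note cmp = green_function_half_periods_compare[OF assms(3)]
  have "G b 0 \<le> G a 0 \<longleftrightarrow> norm (wp b) \<le> norm (wp a)"
    by (rule cmp[OF hp(1,2) distinct(1)]) (use sum e in simp)
  moreover have "G d 0 \<le> G a 0 \<longleftrightarrow> norm (wp d) \<le> norm (wp a)"
    by (rule cmp[OF hp(1,3) distinct(2)]) (use sum e in \<open>simp add: ac_simps\<close>)
  moreover have "G d 0 \<le> G b 0 \<longleftrightarrow> norm (wp d) \<le> norm (wp b)"
    by (rule cmp[OF hp(2,3) distinct(3)]) (use sum e in \<open>simp add: ac_simps\<close>)
  moreover have "G a 0 \<le> G b 0 \<longleftrightarrow> norm (wp a) \<le> norm (wp b)"
    by (rule cmp[OF hp(2,1) distinct(4)]) (use sum e' in \<open>simp add: ac_simps\<close>)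
  moreover have "G a 0 \<le> G d 0 \<longleftrightarrow> norm (wp a) \<le> norm (wp d)"
    by (rule cmp[OF hp(3,1) distinct(5)]) (use sum e' in \<open>simp add: ac_simps\<close>)
  moreover have "G b 0 \<le> G d 0 \<longleftrightarrow> norm (wp b) \<le> norm (wp d)"
    by (rule cmp[OF hp(3,2) distinct(6)]) (use sum e' in \<open>simp add: ac_simps\<close>)
  moreover have "z0 = a \<or> z0 = b \<or> z0 = d" "z1 = a \<or> z1 = b \<or> z1 = d"
    using assms(4,5) by (auto simp: half_period_points_def a_def b_def d_def)
  ultimately show ?thesis by (elim disjE; simp)
qed

end
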